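(* Let $X$ be a hyperbolic Riemann surface and let $F\in\mathrm{Hol}(X,X)$ be a holomorphic self-map of $X$ with an attracting fixed point $z_0\in X$. Then: (i) there exists a neighbourhood $\mathcal{U}$ of $F$ in $\mathrm{Hol}(X,X)$ such that for every sequence $\{f_\nu\}_{\nu\in\mathbb{N}}\subset\mathcal{U}$ the right iterated function system $\{R_\nu\}$ generated by $\{f_\nu\}$, given by $R_\nu=f_0\circ f_1\circ\cdots\circ f_\nu$, converges to a constant in $X$; (ii) if $\{f_\nu\}_{\nu\in\mathbb{N}}\subset\mathrm{Hol}(X,X)$ is a sequence converging to $F$, then the left iterated function system $\{L_\nu\}$ generated by $\{f_\nu\}$, given by $L_\nu=f_\nu\circ f_{\nu-1}\circ\cdots\circ f_0$, converges to the constant $z_0$.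
   Context: A Riemann surface is hyperbolic if its universal covering is the unit disk $\mathbb{D}$. $\mathrm{Hol}(X,X)$ denotes the space of holomorphic self-maps of $X$, endowed with the compact-open topology (equivalently, the topology of uniform convergence on compact subsets); convergence of sequences of maps and neighbourhoods are with respect to this topology. An attracting fixed point of $F\in\mathrm{Hol}(X,X)$ is a point $z_0\in X$ with $F(z_0)=z_0$ and $|F'(z_0)|<1$ (the derivative at a fixed point is computed in any local coordinate around $z_0$ and does not depend on the choice). By convention, the maps generating an iterated function system are all different from the identity $\mathrm{id}_X$. *)

theory Defs
  imports "HOL-Analysis.Analysis"
begin

text \<open>
  A Riemann surface is given by its topology \<^term>\<open>X\<close> together with a holomorphic atlas
  \<^term>\<open>A\<close>, a set of pairs \<^term>\<open>(U, \<phi>)\<close> of a chart domain and a chart map, whose inverse is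
  \<^term>\<open>inv_into U \<phi>\<close>. The atlas need not be maximal. Second countability is not required, as it
  follows from the other axioms (Rado's theorem).
\<close>

type_synonym 'a atlas = "('a set \<times> ('a \<Rightarrow> complex)) set"

definition complex_chart :: "'a topology \<Rightarrow> 'a set \<Rightarrow> ('a \<Rightarrow> complex) \<Rightarrow> bool" where
  "complex_chart X U \<phi> \<longleftrightarrow>
     openin X U \<and> open (\<phi> ` U) \<and>
     homeomorphic_map (subtopology X U) (top_of_set (\<phi> ` U)) \<phi>"

definition riemann_surface :: "'a topology \<Rightarrow> 'a atlas \<Rightarrow> bool" where
  "riemann_surface X A \<longleftrightarrow>
     topspace X \<noteq> {} \<and> Hausdorff_space X \<and> connected_space X \<and>
     (\<forall>(U, \<phi>) \<in> A. complex_chart X U \<phi>) \<and>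
     (\<Union>(U, \<phi>) \<in> A. U) = topspace X \<and>
     (\<forall>(U, \<phi>) \<in> A. \<forall>(V, \<psi>) \<in> A. (\<psi> \<circ> inv_into U \<phi>) holomorphic_on \<phi> ` (U \<inter> V))"

text \<open>
  Maps between surfaces are total functions whose values outside the carrier are irrelevant: the
  set of maps below is closed under composition \<^term>\<open>(\<circ>)\<close>, and maps agreeing on
  \<^term>\<open>topspace X\<close> lie in the same open sets of \<open>hol_topology\<close>.
\<close>

definition holomorphic_maps ::
  "'a topology \<Rightarrow> 'a atlas \<Rightarrow> 'b topology \<Rightarrow> 'b atlas \<Rightarrow> ('a \<Rightarrow> 'b) set" where
  "holomorphic_maps X A Y B =
     {f. continuous_map X Y f \<and>
         (\<forall>(U, \<phi>) \<in> A. \<forall>(V, \<psi>) \<in> B.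
            (\<psi> \<circ> f \<circ> inv_into U \<phi>) holomorphic_on \<phi> ` (U \<inter> f -` V))}"

text \<open>
  The analogue of \<^const>\<open>covering_space\<close> for abstract topologies.
\<close>

definition covering_map :: "'a topology \<Rightarrow> 'b topology \<Rightarrow> ('a \<Rightarrow> 'b) \<Rightarrow> bool" where
  "covering_map X Y p \<longleftrightarrow>
     continuous_map X Y p \<and> p ` topspace X = topspace Y \<and>
     (\<forall>y \<in> topspace Y. \<exists>T. y \<in> T \<and> openin Y T \<and>
        (\<exists>\<V>. \<Union>\<V> = topspace X \<inter> p -` T \<and>
             (\<forall>V \<in> \<V>. openin X V) \<and>
             pairwise disjnt \<V> \<and>
             (\<forall>V \<in> \<V>. homeomorphic_map (subtopology X V) (subtopology Y T) p)))"

definition disc_topology :: "complex topology" where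
  "disc_topology = top_of_set (ball 0 1)"

definition disc_atlas :: "complex atlas" where
  "disc_atlas = {(ball 0 1, id)}"

text \<open>
  Since the disc is simply connected, a holomorphic covering of \<^term>\<open>X\<close> by the disc is the
  universal covering of \<^term>\<open>X\<close>.
\<close>

definition hyperbolic_riemann_surface :: "'a topology \<Rightarrow> 'a atlas \<Rightarrow> bool" where
  "hyperbolic_riemann_surface X A \<longleftrightarrow>
     riemann_surface X A \<and>
     (\<exists>p \<in> holomorphic_maps disc_topology disc_atlas X A. covering_map disc_topology X p)"

definition Hol :: "'a topology \<Rightarrow> 'a atlas \<Rightarrow> ('a \<Rightarrow> 'a) set" where
  "Hol X A = holomorphic_maps X A X A"

text \<open>The compact-open topology on \<^const>\<open>Hol\<close>.\<close>

definition hol_topology :: "'a topology \<Rightarrow> 'a atlas \<Rightarrow> ('a \<Rightarrow> 'a) topology" where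
  "hol_topology X A =
     topology_generated_by
       {{f \<in> Hol X A. f ` K \<subseteq> U} | K U. compactin X K \<and> openin X U}"

definition deriv_in_chart ::
  "'a set \<Rightarrow> ('a \<Rightarrow> complex) \<Rightarrow> ('a \<Rightarrow> 'a) \<Rightarrow> 'a \<Rightarrow> complex" where
  "deriv_in_chart U \<phi> F z = deriv (\<phi> \<circ> F \<circ> inv_into U \<phi>) (\<phi> z)"

text \<open>
  The derivative at a fixed point is the same in all charts around it; see
  \<open>deriv_in_chart_unique\<close> below.
\<close>

definition attracting_fixed_point ::
  "'a topology \<Rightarrow> 'a atlas \<Rightarrow> ('a \<Rightarrow> 'a) \<Rightarrow> 'a \<Rightarrow> bool" where
  "attracting_fixed_point X A F z\<^sub>0 \<longleftrightarrow>
     z\<^sub>0 \<in> topspace X \<and> F z\<^sub>0 = z\<^sub>0 \<and>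
     (\<exists>(U, \<phi>) \<in> A. z\<^sub>0 \<in> U \<and> cmod (deriv_in_chart U \<phi> F z\<^sub>0) < 1)"

definition differs_from_id :: "'a topology \<Rightarrow> ('a \<Rightarrow> 'a) \<Rightarrow> bool" where
  "differs_from_id X f \<longleftrightarrow> (\<exists>z \<in> topspace X. f z \<noteq> z)"

primrec right_ifs :: "(nat \<Rightarrow> 'a \<Rightarrow> 'a) \<Rightarrow> nat \<Rightarrow> 'a \<Rightarrow> 'a" where
  "right_ifs f 0 = f 0"
| "right_ifs f (Suc n) = right_ifs f n \<circ> f (Suc n)"

primrec left_ifs :: "(nat \<Rightarrow> 'a \<Rightarrow> 'a) \<Rightarrow> nat \<Rightarrow> 'a \<Rightarrow> 'a" where
  "left_ifs f 0 = f 0"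
| "left_ifs f (Suc n) = f (Suc n) \<circ> left_ifs f n"


lemma topspace_hol_topology: "topspace (hol_topology X A) = Hol X A"
proof -
  have "Hol X A \<in> {{f \<in> Hol X A. f ` K \<subseteq> U} | K U. compactin X K \<and> openin X U}"
    by (rule CollectI, rule exI[of _ "{}"], rule exI[of _ "{}"]) auto
  then show ?thesis
    unfolding hol_topology_def topology_generated_by_topspace by auto
qed

lemma complex_chart_inverse:
  assumes "complex_chart X U \<phi>" "z \<in> U"
  shows "inv_into U \<phi> (\<phi> z) = z"
proof -
  have "U \<subseteq> topspace X"
    using assms(1) by (simp add: complex_chart_def openin_subset)
  then have "inj_on \<phi> U"
    using assms(1) by (auto simp: complex_chart_def homeomorphic_map_def Int_absorb1)
  then show ?thesis
    using assms(2) by simp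
qed

lemma complex_chart_image_open:
  assumes c: "complex_chart X U \<phi>" and V: "openin X V" "V \<subseteq> U"
  shows "open (\<phi> ` V)"
proof -
  have h: "homeomorphic_map (subtopology X U) (top_of_set (\<phi> ` U)) \<phi>" and o: "open (\<phi> ` U)"
    using c by (auto simp: complex_chart_def)
  have "openin (subtopology X U) V"
    using V by (metis inf.absorb_iff1 openin_subtopology)
  then have "openin (top_of_set (\<phi> ` U)) (\<phi> ` V)"
    using h by (meson homeomorphic_imp_open_map open_map_def)
  then show ?thesis
    using o openin_open_trans by blast
qed

lemma deriv_in_chart_unique:
  assumes X: "riemann_surface X A" and F: "F \<in> Hol X A" and fp: "F z = z"
    and U: "(U, \<phi>) \<in> A" "z \<in> U" and V: "(V, \<psi>) \<in> A" "z \<in> V"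
  shows "deriv_in_chart U \<phi> F z = deriv_in_chart V \<psi> F z"
proof -
  have cU: "complex_chart X U \<phi>" and cV: "complex_chart X V \<psi>"
    using X U V by (auto simp: riemann_surface_def)
  have oU: "openin X U" and oV: "openin X V"
    using cU cV by (auto simp: complex_chart_def)
  define t where "t = \<psi> \<circ> inv_into U \<phi>"
  define s where "s = \<phi> \<circ> inv_into V \<psi>"
  define g where "g = \<phi> \<circ> F \<circ> inv_into U \<phi>"
  define h where "h = \<psi> \<circ> F \<circ> inv_into V \<psi>"
  note invU = complex_chart_inverse[OF cU] and invV = complex_chart_inverse[OF cV]
  have contF: "continuous_map X X F"
    using F by (simp add: Hol_def holomorphic_maps_def)
  define W where "W = {x \<in> topspace X. F x \<in> U \<inter> V} \<inter> (U \<inter> V)"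
  have oW: "openin X W"
    unfolding W_def using contF oU oV
    by (intro openin_Int openin_continuous_map_preimage[of X X F]) auto
  have zW: "z \<in> W"
    using U V fp openin_subset[OF oU] by (auto simp: W_def)
  have t_hol: "t holomorphic_on \<phi> ` (U \<inter> V)" and s_hol: "s holomorphic_on \<psi> ` (V \<inter> U)"
    using X U V by (fastforce simp: riemann_surface_def t_def s_def)+
  have g_hol: "g holomorphic_on \<phi> ` (U \<inter> F -` U)"
    using F U by (fastforce simp: Hol_def holomorphic_maps_def g_def)
  have t: "t field_differentiable at (\<phi> z)"
    using holomorphic_on_imp_differentiable_at[OF t_hol]
      complex_chart_image_open[OF cU, of "U \<inter> V"] oU oV U V by auto
  have s: "s field_differentiable at (\<psi> z)"
    using holomorphic_on_imp_differentiable_at[OF s_hol]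
      complex_chart_image_open[OF cV, of "V \<inter> U"] oU oV U V by auto
  have g: "g field_differentiable at (\<phi> z)"
    using holomorphic_on_imp_differentiable_at[OF holomorphic_on_subset[OF g_hol, of "\<phi> ` W"]]
      complex_chart_image_open[OF cU oW] zW by (auto simp: W_def)
  have [simp]: "s (\<psi> z) = \<phi> z" "t (\<phi> z) = \<psi> z" "g (\<phi> z) = \<phi> z"
    using U V fp invU invV by (auto simp: s_def t_def g_def)
  have oW': "open (\<psi> ` W)"
    using complex_chart_image_open[OF cV oW] by (auto simp: W_def)
  have h_eq: "\<forall>\<^sub>F w in nhds (\<psi> z). h w = (t \<circ> (g \<circ> s)) w"
  proof (rule eventually_mono)
    show "\<forall>\<^sub>F w in nhds (\<psi> z). w \<in> \<psi> ` W"
      using oW' zW by (intro eventually_nhds_in_open) auto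
  qed (use invU invV in \<open>auto simp: W_def h_def t_def g_def s_def\<close>)
  have id_eq: "\<forall>\<^sub>F w in nhds (\<psi> z). (t \<circ> s) w = w"
  proof (rule eventually_mono)
    show "\<forall>\<^sub>F w in nhds (\<psi> z). w \<in> \<psi> ` W"
      using oW' zW by (intro eventually_nhds_in_open) auto
  qed (use invU invV in \<open>auto simp: W_def t_def s_def\<close>)
  have gs: "(g \<circ> s) field_differentiable at (\<psi> z)"
    using s g by (intro field_differentiable_compose) auto
  have "deriv t (\<phi> z) * deriv s (\<psi> z) = deriv (t \<circ> s) (\<psi> z)"
    using s t by (subst deriv_chain) auto
  also have "\<dots> = deriv (\<lambda>w. w) (\<psi> z)"
    by (rule deriv_cong_ev[OF id_eq refl])
  finally have 1: "deriv t (\<phi> z) * deriv s (\<psi> z) = 1"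
    by simp
  have "deriv h (\<psi> z) = deriv (t \<circ> (g \<circ> s)) (\<psi> z)"
    by (rule deriv_cong_ev[OF h_eq refl])
  also have "\<dots> = deriv t (\<phi> z) * deriv (g \<circ> s) (\<psi> z)"
    using gs t by (subst deriv_chain) auto
  also have "deriv (g \<circ> s) (\<psi> z) = deriv g (\<phi> z) * deriv s (\<psi> z)"
    using g s by (subst deriv_chain) auto
  finally have "deriv h (\<psi> z) = deriv g (\<phi> z)"
    using 1 by (simp add: algebra_simps)
  then show ?thesis
    by (simp add: deriv_in_chart_def g_def h_def)
qed

end

theory Submission
  imports Defs "HOL-Complex_Analysis.Riemann_Mapping"
begin

text \<open>
  Choose the universal covering \<open>p\<close> of \<open>X\<close> by the disc with \<open>p 0 = z\<^sub>0\<close> and lift self-maps of \<open>X\<close> to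
  self-maps of the disc. The lift of \<open>F\<close> fixing \<open>0\<close> sends \<open>|z| \<le> r\<close> into \<open>|z| < \<kappa> r\<close> with \<open>\<kappa> < 1\<close>, and for
  small \<open>r\<close> this is an open condition on self-maps of \<open>X\<close>: a map close to \<open>F\<close> has a lift \<open>g\<close> with the same
  property and with \<open>g 0\<close> close to \<open>0\<close>. By the Cauchy estimates such a \<open>g\<close> is a Euclidean contraction on a
  smaller disc \<open>|z| \<le> s\<close>, which it maps into itself. By the Schwarz--Pick lemma, with the bound on
  \<open>g'(0)\<close> taken into account, outside this small disc \<open>g\<close> decreases the hyperbolic distance to \<open>0\<close> by
  at least a positive constant which is the same for all these \<open>g\<close>. Hence the number of factors needed to
  bring a compact set into the small disc is uniform. For left systems this suffices, as the small disc can
  be chosen arbitrarily small. For right systems, the remaining outer factors contract the small disc to a point.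
\<close>

section \<open>Self-maps of the disc\<close>

text \<open>The exponential of the hyperbolic distance (for curvature \<open>-1\<close>) between \<open>0\<close> and a point of modulus \<open>t\<close>.\<close>

definition poinc :: "real \<Rightarrow> real" where
  "poinc t = (1 + t) / (1 - t)"

lemma poinc_mono: "s \<le> t \<Longrightarrow> t < 1 \<Longrightarrow> poinc s \<le> poinc t"
  by (simp add: poinc_def divide_simps) argo

lemma poinc_le_iff: "s < 1 \<Longrightarrow> t < 1 \<Longrightarrow> poinc s \<le> poinc t \<longleftrightarrow> s \<le> t"
  by (simp add: poinc_def divide_simps) argo

lemma poinc_ge_1: "0 \<le> t \<Longrightarrow> t < 1 \<Longrightarrow> 1 \<le> poinc t"
  by (simp add: poinc_def divide_simps)

text \<open>The value (s + t) / (1 + s * t) is the modulus of the point of the positive radius whose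
  hyperbolic distance to 0 is the sum of those of s and t. Addition of distances becomes
  multiplication under \<open>poinc\<close>.\<close>

lemma poinc_add:
  assumes "0 \<le> s" "s < 1" "0 \<le> t" "t < 1"
  shows "(s + t) / (1 + s * t) < 1" "poinc ((s + t) / (1 + s * t)) = poinc s * poinc t"
proof -
  have p: "0 < 1 + s * t" using assms by (simp add: add_pos_nonneg)
  have "0 < (1 - s) * (1 - t)" using assms by simp
  then have l: "s + t < 1 + s * t" by (simp add: algebra_simps)
  then show "(s + t) / (1 + s * t) < 1" using p by simp
  have "(1 + (s + t) / (1 + s * t)) = (1 + s) * (1 + t) / (1 + s * t)"
    "(1 - (s + t) / (1 + s * t)) = (1 - s) * (1 - t) / (1 + s * t)"
    using p by (simp_all add: field_simps)
  then show "poinc ((s + t) / (1 + s * t)) = poinc s * poinc t"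
    using p by (simp add: poinc_def)
qed

text \<open>This is the hyperbolic triangle inequality through 0: a disc automorphism that sends b
  to 0 preserves hyperbolic distance, so the left side is the exponential of the distance between w
  and b.\<close>

lemma poinc_Moebius_le:
  assumes w: "cmod w < 1" and b: "cmod b < 1"
  shows "poinc (cmod (Moebius_function 0 b w)) \<le> poinc (cmod w) * poinc (cmod b)"
proof -
  let ?N = "cmod (1 - cnj b * w)" and ?P = "1 + cmod w * cmod b"
  let ?c = "(1 - (cmod b)\<^sup>2) * (1 - (cmod w)\<^sup>2)"
  have "cmod (cnj b * w) < 1"
    using mult_strict_mono[OF b w] by (simp add: norm_mult)
  then have N0: "?N > 0"
    by auto
  have NP: "?N \<le> ?P"
    using norm_triangle_ineq4[of 1 "cnj b * w"] by (simp add: norm_mult mult.commute)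
  have P0: "?P > 0"
    by (simp add: add_pos_nonneg)
  \<comment> \<open>By \<open>eq\<close> and \<open>eq'\<close>, both squared quotients have the
    form 1 - \<open>?c\<close> / x^2 with the same \<open>?c\<close>, where x is \<open>?N\<close>
    or \<open>?P\<close>. Hence \<open>?N\<close> \<le> \<open>?P\<close> suffices to compare
    them.\<close>
  have eq: "(cmod (w - b))\<^sup>2 = ?N\<^sup>2 - ?c"
    unfolding cmod_power2 by (simp add: power2_eq_square algebra_simps)
  have eq': "(cmod w + cmod b)\<^sup>2 = ?P\<^sup>2 - ?c"
    by (simp add: power2_eq_square algebra_simps)
  have c0: "?c \<ge> 0"
    using w b by (simp add: abs_square_le_1)
  have "?c * ?N\<^sup>2 \<le> ?c * ?P\<^sup>2"
    using NP N0 c0 by (intro mult_left_mono power_mono) auto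
  then have "(cmod (w - b) * ?P)\<^sup>2 \<le> ((cmod w + cmod b) * ?N)\<^sup>2"
    unfolding power_mult_distrib eq eq' by (simp add: algebra_simps)
  then have "cmod (w - b) * ?P \<le> (cmod w + cmod b) * ?N"
    by (rule power2_le_imp_le) simp
  then have "cmod (Moebius_function 0 b w) \<le> (cmod w + cmod b) / ?P"
    using N0 P0 by (simp add: Moebius_function_simple norm_divide divide_simps mult.commute)
  then have "poinc (cmod (Moebius_function 0 b w)) \<le> poinc ((cmod w + cmod b) / ?P)"
    using w b by (intro poinc_mono poinc_add) auto
  also have "\<dots> = poinc (cmod w) * poinc (cmod b)"
    using w b by (intro poinc_add) auto
  finally show ?thesis .
qed

section \<open>Schwarz-Pick estimates, with and without a bound on the derivative at 0\<close>

lemma deriv_Moebius_self: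
  assumes "cmod b < 1"
  shows "(Moebius_function 0 b has_field_derivative 1 / (1 - of_real ((cmod b)\<^sup>2))) (at b)"
proof -
  have "cnj b * b = of_real ((cmod b)\<^sup>2)"
    by (metis complex_norm_square mult.commute)
  moreover have "(cmod b)\<^sup>2 < 1"
    using assms by (simp add: abs_square_less_1)
  ultimately have ne: "1 - cnj b * b \<noteq> 0"
    by (metis eq_iff_diff_eq_0 less_irrefl of_real_eq_1_iff)
  have "((\<lambda>w. (w - b) / (1 - cnj b * w)) has_field_derivative 1 / (1 - cnj b * b)) (at b)"
    using ne by (auto intro!: derivative_eq_intros simp: divide_simps)
  then show ?thesis
    using \<open>cnj b * b = _\<close> by (simp add: Moebius_function_simple[abs_def])
qed

text \<open>Moving k 0 to 0 by a disc automorphism reduces the claim to the Schwarz lemma. Undoing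
  the automorphism costs at most the distance from k 0 to 0, by the triangle inequality.\<close>

lemma Schwarz_Pick_0:
  assumes k: "k holomorphic_on ball 0 1" "k ` ball 0 1 \<subseteq> ball 0 1" and z: "cmod z < 1"
  shows "poinc (cmod (k z)) \<le> poinc (cmod z) * poinc (cmod (k 0))"
proof -
  define h where "h = Moebius_function 0 (k 0) \<circ> k"
  have kn: "cmod (k w) < 1" if "cmod w < 1" for w
    using k(2) that by (simp add: image_subset_iff)
  have "h holomorphic_on ball 0 1"
    unfolding h_def using k kn[of 0]
    by (intro holomorphic_on_compose_gen[of _ _ _ "ball 0 1"] Moebius_function_holomorphic) auto
  moreover have "cmod (h w) < 1" if "cmod w < 1" for w
    using kn that by (simp add: h_def Moebius_function_norm_lt_1)
  moreover have "h 0 = 0"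
    by (simp add: h_def Moebius_function_eq_zero)
  ultimately have hz: "cmod (h z) \<le> cmod z"
    using Schwarz_Lemma(1) z by blast
  have "k z = Moebius_function 0 (- k 0) (h z)"
    using kn z by (simp add: h_def Moebius_function_compose)
  then have "poinc (cmod (k z)) \<le> poinc (cmod (h z)) * poinc (cmod (- k 0))"
    using hz z kn[of 0] poinc_Moebius_le[of "h z" "- k 0"] by simp
  also have "\<dots> \<le> poinc (cmod z) * poinc (cmod (- k 0))"
    using hz z kn[of 0] poinc_ge_1[of "cmod (k 0)"]
    by (intro mult_right_mono poinc_mono) auto
  finally show ?thesis by simp
qed

text \<open>Divide out the zero: h z = z * k z, where k again maps the disc into itself and k 0 is
  the derivative of h at 0. The Schwarz-Pick estimate for k improves on the bound 1 for its modulus,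
  and the gain is quantified in terms of a.\<close>

lemma Schwarz_deriv_less_1:
  assumes h: "h holomorphic_on ball 0 1" "h 0 = 0" "\<And>z. cmod z < 1 \<Longrightarrow> cmod (h z) < 1"
    and d: "cmod (deriv h 0) \<le> a" "a < 1" and z: "cmod z < 1"
  shows "poinc (cmod (h z)) \<le> poinc (cmod z) * (1 - (1 - a) * cmod z / 2)"
proof -
  obtain k where k: "k holomorphic_on ball 0 1" "\<And>z. cmod z < 1 \<Longrightarrow> h z = z * k z" "deriv h 0 = k 0"
    using Schwarz3[OF h(1,2)] by metis
  have "\<not> cmod (deriv h 0) = 1"
    using d by simp
  have k1: "cmod (k w) < 1" if w: "cmod w < 1" for w
  proof (cases "w = 0")
    case True
    then show ?thesis using d k by auto
  next
    case False
    \<comment> \<open>Equality in the Schwarz lemma would make h a rotation, whose derivative at 0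
      has modulus 1 > a.\<close>
    have "\<not> cmod (h w) = cmod w"
    proof
      assume "cmod (h w) = cmod w"
      then obtain \<alpha> where al: "\<And>z. cmod z < 1 \<Longrightarrow> h z = \<alpha> * z" "cmod \<alpha> = 1"
        using Schwarz_Lemma(3)[OF h w] w False by blast
      have "(h has_field_derivative \<alpha>) (at 0)"
      proof (rule has_field_derivative_transform_within_open)
        show "((*) \<alpha> has_field_derivative \<alpha>) (at 0)"
          by (auto intro!: derivative_eq_intros)
        show "open (ball 0 (1::real) :: complex set)" by simp
      qed (use al in auto)
      then show False
        using al(2) d by (auto simp: DERIV_imp_deriv)
    qed
    then have "cmod (h w) < cmod w"
      using Schwarz_Lemma(1)[OF h w] by simp
    then show ?thesis
      using k(2)[OF w] False by (simp add: norm_mult)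
  qed
  define \<rho> where "\<rho> = cmod z"
  have a0: "0 \<le> a" using d norm_ge_zero order_trans by blast
  have \<rho>: "0 \<le> \<rho>" "\<rho> < 1" using z by (auto simp: \<rho>_def)
  have "poinc (cmod (k z)) \<le> poinc (cmod z) * poinc (cmod (k 0))"
    using k1 z by (intro Schwarz_Pick_0 k) auto
  also have "\<dots> \<le> poinc \<rho> * poinc a"
    using d k(3) poinc_ge_1[OF \<rho>] unfolding \<rho>_def[symmetric] by (intro mult_left_mono poinc_mono) auto
  also have "\<dots> = poinc ((\<rho> + a) / (1 + \<rho> * a))"
    using poinc_add[OF \<rho> a0 d(2)] by simp
  finally have kz: "cmod (k z) \<le> (\<rho> + a) / (1 + \<rho> * a)"
    using poinc_add[OF \<rho> a0 d(2)] poinc_le_iff[OF k1[OF z]] by metis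
  have pos: "0 < 1 + \<rho> * a" using \<rho> a0 by (simp add: add_pos_nonneg)
  have lt: "\<rho> * ((\<rho> + a) / (1 + \<rho> * a)) < 1"
    using poinc_add(1)[OF \<rho> a0 d(2)] \<rho>
    by (smt (verit, best) mult_less_cancel_right2 mult_right_le_one_le mult_nonneg_nonneg divide_nonneg_nonneg a0)
  have "cmod (h z) \<le> \<rho> * ((\<rho> + a) / (1 + \<rho> * a))"
    using k(2)[OF z] kz \<rho> unfolding \<rho>_def[symmetric] norm_mult
    by (simp add: norm_mult \<rho>_def[symmetric] mult_left_mono del: times_divide_eq_right)
  then have "poinc (cmod (h z)) \<le> poinc (\<rho> * ((\<rho> + a) / (1 + \<rho> * a)))"
    using lt by (rule poinc_mono)
  also have "\<dots> = (1 + 2 * a * \<rho> + \<rho>\<^sup>2) / (1 - \<rho>\<^sup>2)"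
  proof -
    have "1 + \<rho> * ((\<rho> + a) / (1 + \<rho> * a)) = (1 + 2 * a * \<rho> + \<rho>\<^sup>2) / (1 + \<rho> * a)"
      "1 - \<rho> * ((\<rho> + a) / (1 + \<rho> * a)) = (1 - \<rho>\<^sup>2) / (1 + \<rho> * a)"
      using pos by (simp_all add: field_simps power2_eq_square)
    then show ?thesis using pos by (simp add: poinc_def)
  qed
  also have "\<dots> = poinc \<rho> * ((1 + 2 * a * \<rho> + \<rho>\<^sup>2) / (1 + \<rho>)\<^sup>2)"
  proof -
    have "(1 - \<rho>\<^sup>2) = (1 - \<rho>) * (1 + \<rho>)" by (simp add: power2_eq_square algebra_simps)
    then show ?thesis
      using \<rho> by (simp add: poinc_def power2_eq_square)
  qed
  also have "\<dots> \<le> poinc \<rho> * (1 - (1 - a) * \<rho> / 2)"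
  proof (rule mult_left_mono)
    \<comment> \<open>The numerator is P - 2 * E, and P \<le> 4 gives 2 * E \<ge> E * P / 2. This
      trades the exact factor for one that is linear in \<rho>.\<close>
    define E P where "E = (1 - a) * \<rho>" and "P = (1 + \<rho>)\<^sup>2"
    have "P \<le> 2\<^sup>2"
      unfolding P_def using \<rho> by (intro power_mono) auto
    then have "E * P \<le> E * 4"
      unfolding E_def using \<rho> d by (intro mult_left_mono) auto
    moreover have "1 + 2 * a * \<rho> + \<rho>\<^sup>2 = P - 2 * E"
      by (simp add: E_def P_def algebra_simps power2_eq_square)
    ultimately have "1 + 2 * a * \<rho> + \<rho>\<^sup>2 \<le> (1 - E / 2) * P"
      by (simp add: algebra_simps)
    then show "(1 + 2 * a * \<rho> + \<rho>\<^sup>2) / (1 + \<rho>)\<^sup>2 \<le> 1 - (1 - a) * \<rho> / 2"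
      using \<rho> by (simp add: pos_divide_le_eq E_def P_def)
  qed (use poinc_ge_1[OF \<rho>] in auto)
  finally show ?thesis by (simp add: \<rho>_def)
qed

text \<open>Composing g with the automorphism that moves g 0 to 0 divides its derivative at 0 by 1 -
  |g 0|^2. Hypothesis \<open>d\<close> keeps the result below a, so the previous estimate applies;
  the way back costs the factor \<open>poinc \<beta>\<close>.\<close>

lemma Schwarz_Pick_deriv:
  assumes g: "g holomorphic_on ball 0 1" "g ` ball 0 1 \<subseteq> ball 0 1"
    and b: "cmod (g 0) \<le> \<beta>" "\<beta> < 1"
    and d: "cmod (deriv g 0) \<le> a * (1 - \<beta>\<^sup>2)" "a < 1" and z: "cmod z < 1"
  shows "poinc (cmod (g z)) \<le> poinc \<beta> * (1 - (1 - a) * cmod z / 2) * poinc (cmod z)"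
proof -
  define h where "h = Moebius_function 0 (g 0) \<circ> g"
  have gn: "cmod (g w) < 1" if "cmod w < 1" for w
    using g(2) that by (simp add: image_subset_iff)
  have \<beta>0: "0 \<le> \<beta>" using b norm_ge_zero order_trans by blast
  have \<beta>1: "0 < 1 - \<beta>\<^sup>2" using \<beta>0 b by (simp add: abs_square_less_1)
  have h: "h holomorphic_on ball 0 1"
    unfolding h_def using g gn[of 0]
    by (intro holomorphic_on_compose_gen[of _ _ _ "ball 0 1"] Moebius_function_holomorphic) auto
  have h1: "cmod (h w) < 1" if "cmod w < 1" for w
    using gn that by (simp add: h_def Moebius_function_norm_lt_1)
  have h0: "h 0 = 0"
    by (simp add: h_def Moebius_function_eq_zero)
  have "(g has_field_derivative deriv g 0) (at 0)"
    using g(1) by (intro holomorphic_derivI[of _ "ball 0 1"]) auto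
  then have "(h has_field_derivative 1 / (1 - of_real ((cmod (g 0))\<^sup>2)) * deriv g 0) (at 0)"
    unfolding h_def using gn[of 0] by (intro DERIV_chain deriv_Moebius_self) auto
  then have "deriv h 0 = deriv g 0 / of_real (1 - (cmod (g 0))\<^sup>2)"
    by (simp add: DERIV_imp_deriv)
  moreover have sq: "(cmod (g 0))\<^sup>2 \<le> \<beta>\<^sup>2"
    using b by (intro power_mono) auto
  ultimately have "cmod (deriv h 0) = cmod (deriv g 0) / (1 - (cmod (g 0))\<^sup>2)"
    using \<beta>1 by (simp add: norm_divide del: of_real_diff)
  also have "\<dots> \<le> cmod (deriv g 0) / (1 - \<beta>\<^sup>2)"
    using sq \<beta>1 by (intro divide_left_mono mult_pos_pos) auto
  also have "\<dots> \<le> a"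
    using d \<beta>1 by (simp add: pos_divide_le_eq)
  finally have hz: "poinc (cmod (h z)) \<le> poinc (cmod z) * (1 - (1 - a) * cmod z / 2)"
    using h h0 h1 d z by (intro Schwarz_deriv_less_1) auto
  have "g z = Moebius_function 0 (- g 0) (h z)"
    using gn z by (simp add: h_def Moebius_function_compose)
  then have "poinc (cmod (g z)) \<le> poinc (cmod (h z)) * poinc (cmod (- g 0))"
    using h1[OF z] gn[of 0] poinc_Moebius_le[of "h z" "- g 0"] by simp
  also have "\<dots> \<le> poinc (cmod (h z)) * poinc \<beta>"
    using h1[OF z] b poinc_ge_1[of "cmod (h z)"] by (intro mult_left_mono poinc_mono) auto
  also have "\<dots> \<le> (poinc (cmod z) * (1 - (1 - a) * cmod z / 2)) * poinc \<beta>"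
    using hz poinc_ge_1[OF \<beta>0 b(2)] by (intro mult_right_mono) auto
  finally show ?thesis by (simp add: mult_ac)
qed

text \<open>Two metrics are used: the Euclidean one inside the disc of radius r, the hyperbolic one
  outside. For 0 < q < 1, the factor q on \<open>poinc\<close> means a loss of at least - ln q in
  hyperbolic distance to 0. Holomorphy is left out, so that the iteration arguments are purely
  metric.\<close>

definition disc_contraction :: "real \<Rightarrow> real \<Rightarrow> real \<Rightarrow> (complex \<Rightarrow> complex) \<Rightarrow> bool" where
  "disc_contraction q \<mu> r g \<longleftrightarrow>
     g ` ball 0 1 \<subseteq> ball 0 1 \<and> g ` cball 0 r \<subseteq> cball 0 r \<and>
     (\<forall>z \<in> cball 0 r. \<forall>w \<in> cball 0 r. dist (g z) (g w) \<le> \<mu> * dist z w) \<and>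
     (\<forall>z \<in> ball 0 1. r \<le> cmod z \<longrightarrow> poinc (cmod (g z)) \<le> q * poinc (cmod z))"

text \<open>The constants depend on \<kappa>, r and s alone and serve all g at once; this uniformity
  is what makes infinite compositions tractable. The radius s is left free because left systems need
  it arbitrarily small.\<close>

lemma holomorphic_disc_contraction:
  assumes \<kappa>: "0 < \<kappa>" "\<kappa> < 1" and r: "0 < r" "r < 1" and s: "0 < s" "s \<le> (1 - \<kappa>) / 2 * r"
  obtains \<beta> q \<mu> where "0 < \<beta>" "0 \<le> q" "q < 1" "0 \<le> \<mu>" "\<mu> < 1"
    "\<And>g. g holomorphic_on ball 0 1 \<Longrightarrow> g ` ball 0 1 \<subseteq> ball 0 1 \<Longrightarrow>
       g ` cball 0 r \<subseteq> ball 0 (\<kappa> * r) \<Longrightarrow> cmod (g 0) \<le> \<beta> \<Longrightarrow> disc_contraction q \<mu> s g"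
proof -
  \<comment> \<open>About a point of \<open>cball 0 s\<close>, the circle of radius r - s \<ge> (1 +
    \<kappa>) / 2 * r lies in \<open>cball 0 r\<close>, where |g| \<le> \<kappa> * r. The Cauchy
    estimate then bounds the derivative by \<mu>. Taking a strictly between \<mu> and 1 leaves room
    for the factor 1 - \<beta>^2.\<close>
  define \<mu> where "\<mu> = 2 * \<kappa> / (1 + \<kappa>)"
  define a where "a = (1 + \<mu>) / 2"
  have \<mu>: "0 < \<mu>" "\<mu> < 1" using \<kappa> by (auto simp: \<mu>_def divide_simps)
  have a: "\<mu> < a" "a < 1" "0 < a" using \<mu> by (auto simp: a_def)
  have "(1 - \<kappa>) / 2 * r < 1 * r" using r \<kappa> by (intro mult_strict_right_mono) auto
  then have sr: "s < r" using s(2) by simp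
  have fac: "0 < (1 - a) * s / 2" "(1 - a) * s / 2 < 1"
    using a s sr r mult_strict_mono[of "1 - a" 1 s 1] by auto
  \<comment> \<open>Three conditions make \<beta> small: \<mu> < a * (1 - \<beta>^2) for the
    derivative hypothesis, Q \<beta> < 1 so that the gain beats the cost of moving g 0, and \<beta>
    < (1 - \<mu>) * s so that the small disc is mapped into itself. All hold near 0 from the right,
    since Q tends to 1 - (1 - a) * s / 2 there.\<close>
  define Q where "Q = (\<lambda>\<beta>. poinc \<beta> * (1 - (1 - a) * s / 2))"
  have "((\<lambda>\<beta>. a * (1 - \<beta>\<^sup>2)) \<longlongrightarrow> a * (1 - 0\<^sup>2)) (at_right 0)"
    by (intro tendsto_intros)
  then have e1: "\<forall>\<^sub>F \<beta> in at_right 0. \<mu> < a * (1 - \<beta>\<^sup>2)"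
    using a(1) by (intro order_tendstoD(1)) auto
  have "(Q \<longlongrightarrow> (1 + 0) / (1 - 0) * (1 - (1 - a) * s / 2)) (at_right 0)"
    unfolding Q_def poinc_def by (intro tendsto_intros) auto
  then have e2: "\<forall>\<^sub>F \<beta> in at_right 0. Q \<beta> < 1"
    using fac by (intro order_tendstoD(2)) auto
  have e3: "\<forall>\<^sub>F \<beta> in at_right 0. 0 < \<beta> \<and> \<beta> < (1 - \<mu>) * s"
    using \<mu> s by (intro eventually_conj eventually_at_right_less eventually_at_rightI[of 0 "(1 - \<mu>) * s"]) auto
  obtain \<beta> where \<beta>: "\<mu> < a * (1 - \<beta>\<^sup>2)" "Q \<beta> < 1" "0 < \<beta>" "\<beta> < (1 - \<mu>) * s"
    using eventually_happens[OF eventually_conj[OF e1 eventually_conj[OF e2 e3]]] by auto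
  have "(1 - \<mu>) * s < 1 * 1" using \<mu> s sr r by (intro mult_strict_mono) auto
  then have \<beta>1: "\<beta> < 1" using \<beta> by simp
  show thesis
  proof
    show "0 < \<beta>" "Q \<beta> < 1" "0 \<le> \<mu>" "\<mu> < 1" using \<beta> \<mu> by auto
    show "0 \<le> Q \<beta>" using fac poinc_ge_1[of \<beta>] \<beta> \<beta>1 by (simp add: Q_def)
  next
    fix g assume g: "g holomorphic_on ball 0 1" "g ` ball 0 1 \<subseteq> ball 0 1"
      "g ` cball 0 r \<subseteq> ball 0 (\<kappa> * r)" and g0: "cmod (g 0) \<le> \<beta>"
    have der: "cmod (deriv g z) \<le> \<mu>" if z: "z \<in> cball 0 s" for z
    proof -
      have sub: "cball z (r - s) \<subseteq> cball 0 r"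
      proof
        fix w assume "w \<in> cball z (r - s)"
        then show "w \<in> cball 0 r"
          using z norm_triangle_ineq2[of w z] by (simp add: dist_norm norm_minus_commute)
      qed
      then have sub1: "cball z (r - s) \<subseteq> ball 0 1"
        using r by (auto simp: subset_iff)
      have "cmod ((deriv ^^ 1) g z) \<le> fact 1 * (\<kappa> * r) / (r - s) ^ 1"
      proof (rule Cauchy_inequality)
        show "g holomorphic_on ball z (r - s)"
          using g(1) sub1 by (meson ball_subset_cball holomorphic_on_subset order_trans)
        show "continuous_on (cball z (r - s)) g"
          using g(1) sub1 by (meson holomorphic_on_subset holomorphic_on_imp_continuous_on)
        fix x assume "cmod (z - x) = r - s"
        then have "x \<in> cball 0 r" using sub by (metis dist_norm mem_cball order_refl subsetD)
        then show "cmod (g x) \<le> \<kappa> * r" using g(3) by fastforce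
      qed (use sr in auto)
      also have "\<dots> \<le> (\<kappa> * r) / ((1 + \<kappa>) / 2 * r)"
      proof -
        have "(1 + \<kappa>) / 2 * r \<le> r - s"
          using s(2) by (simp add: field_simps)
        then show ?thesis
          using sr r \<kappa> unfolding fact_1 mult_1 power_one_right
            by (intro divide_left_mono) auto
      qed
      also have "\<dots> = \<mu>"
        using r \<kappa> by (simp add: \<mu>_def)
      finally show ?thesis by simp
    qed
    have lip: "dist (g z) (g w) \<le> \<mu> * dist z w" if "z \<in> cball 0 s" "w \<in> cball 0 s" for z w
    proof -
      have "norm (g z - g w) \<le> \<mu> * norm (z - w)"
      proof (rule field_differentiable_bound)
        fix x :: complex assume x: "x \<in> cball 0 s"
        then have "x \<in> ball 0 1" using sr r by auto
        then show "(g has_field_derivative deriv g x) (at x within cball 0 s)"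
          using g(1) by (meson holomorphic_derivI open_ball)
      qed (use that der in auto)
      then show ?thesis by (simp add: dist_norm)
    qed
    have "g z \<in> cball 0 s" if z: "z \<in> cball 0 s" for z
    proof -
      have "dist (g z) (g 0) \<le> \<mu> * s"
        using lip[OF z, of 0] z s \<mu> by (auto intro: order_trans mult_left_mono)
      then have "cmod (g z) \<le> \<mu> * s + cmod (g 0)"
        using norm_triangle_ineq2[of "g z" "g 0"] by (simp add: dist_norm)
      also have "\<dots> \<le> s" using g0 \<beta>(4) by (simp add: algebra_simps)
      finally show ?thesis by simp
    qed
    moreover have "poinc (cmod (g z)) \<le> Q \<beta> * poinc (cmod z)" if z: "z \<in> ball 0 1" "s \<le> cmod z" for z
    proof -
      have "poinc (cmod (g z)) \<le> poinc \<beta> * (1 - (1 - a) * cmod z / 2) * poinc (cmod z)"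
        using g g0 \<beta>1 a z der[of 0] \<beta>(1) s by (intro Schwarz_Pick_deriv) auto
      \<comment> \<open>The contraction factor decreases as |z| grows, so on s \<le> |z| its value
        at s is the worst case.\<close>
      also have "\<dots> \<le> Q \<beta> * poinc (cmod z)"
        unfolding Q_def using z a poinc_ge_1[of "cmod z"] poinc_ge_1[of \<beta>] \<beta> \<beta>1
        by (intro mult_right_mono mult_left_mono) (auto intro: mult_left_mono)
      finally show ?thesis .
    qed
    ultimately show "disc_contraction (Q \<beta>) \<mu> s g"
      using lip g(2) by (auto simp: disc_contraction_def)
  qed
qed

section \<open>Iterated function systems of contractions\<close>

text \<open>Outside the small disc each step multiplies \<open>poinc\<close> by at most q, but
  \<open>poinc\<close> never drops below 1 on [0, 1). So the orbit enters the disc within n steps,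
  and it stays there. The bound n depends only on s, and the maps \<open>h k\<close> may come in any
  order, which covers both left and right systems.\<close>

lemma disc_contraction_iterate:
  assumes h: "\<And>k. disc_contraction q \<mu> r (h k)" and q: "0 \<le> q"
    and w: "\<And>k. w (Suc k) = h k (w k)" and w0: "cmod (w 0) \<le> s" "s < 1"
    and n: "q ^ n * poinc s < 1" and m: "n \<le> m"
  shows "cmod (w m) \<le> r"
proof -
  have D: "cmod (w k) < 1" for k
  proof (induction k)
    case (Suc k)
    then show ?case using h[of k] by (simp add: w disc_contraction_def image_subset_iff)
  qed (use w0 in simp)
  have inv: "cmod (w k) \<le> r \<Longrightarrow> cmod (w (Suc k)) \<le> r" for k
    using h[of k] by (simp add: w disc_contraction_def image_subset_iff)
  have "cmod (w k) \<le> r \<or> poinc (cmod (w k)) \<le> q ^ k * poinc s" for k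
  proof (induction k)
    case 0
    then show ?case using w0 by (simp add: poinc_mono)
  next
    case (Suc k)
    show ?case
    proof (cases "cmod (w k) \<le> r")
      case True
      then show ?thesis using inv by blast
    next
      case False
      then have "poinc (cmod (w (Suc k))) \<le> q * poinc (cmod (w k))"
        using h[of k] D[of k] by (simp add: w disc_contraction_def)
      also have "\<dots> \<le> q * (q ^ k * poinc s)"
        using Suc False q by (intro mult_left_mono) auto
      finally show ?thesis by (simp add: mult_ac)
    qed
  qed
  from this[of n] have "cmod (w n) \<le> r"
    using n poinc_ge_1[OF _ D[of n]] by fastforce
  with m show ?thesis
    by (induction m rule: dec_induct) (auto intro: inv)
qed

text \<open>Only the maps after index N need to contract: the initial composition enters solely
  through the hypothesis that it keeps the image of K in a disc of radius s < 1.\<close>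

lemma disc_contraction_left_ifs:
  assumes g: "\<And>n. N < n \<Longrightarrow> disc_contraction q \<mu> r (g n)" and q: "0 \<le> q" "q < 1"
    and K: "left_ifs g N ` K \<subseteq> cball 0 s" "0 \<le> s" "s < 1"
  shows "\<forall>\<^sub>F n in sequentially. left_ifs g n ` K \<subseteq> cball 0 r"
proof -
  have "(\<lambda>n. q ^ n * poinc s) \<longlonglongrightarrow> 0 * poinc s"
    using q by (intro tendsto_intros LIMSEQ_power_zero) auto
  from eventually_happens[OF order_tendstoD(2)[OF this, of 1]]
  obtain M where M: "q ^ M * poinc s < 1"
    by auto
  have "left_ifs g n ` K \<subseteq> cball 0 r" if n: "N + M \<le> n" for n
  proof clarify
    fix z assume z: "z \<in> K"
    \<comment> \<open>The orbit starts at \<open>left_ifs g N z\<close>, which already includes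
      \<open>g N\<close>, so step k applies \<open>g (N + Suc k)\<close>.\<close>
    have "cmod (left_ifs g (N + (n - N)) z) \<le> r"
    proof (rule disc_contraction_iterate[where h = "\<lambda>k. g (N + Suc k)"
          and w = "\<lambda>k. left_ifs g (N + k) z" and s = s and n = M])
      show "disc_contraction q \<mu> r (g (N + Suc k))" for k
        by (rule g) simp
      show "cmod (left_ifs g (N + 0) z) \<le> s"
        using K z by auto
    qed (use q K M n in auto)
    then show "left_ifs g n z \<in> cball 0 r"
      using n by simp
  qed
  then show ?thesis
    unfolding eventually_sequentially by blast
qed

text \<open>In a right system the map of largest index acts first. The recursion applies f n, f (n -
  1), ... for k steps; what remains outside is again a right system.\<close>

lemma right_ifs_split:
  "k \<le> n \<Longrightarrow> right_ifs f n z = right_ifs f (n - k) (rec_nat z (\<lambda>j. f (n - j)) k)"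
proof (induction k)
  case (Suc k)
  then have "n - k = Suc (n - Suc k)" by simp
  then show ?case using Suc by simp
qed simp

text \<open>The images of the small disc under the right compositions are nested with diameters at
  most 2 * \<mu>^n, so they shrink to a point c. A larger disc is first carried into the small one
  by a fixed number of inner factors. The point c is fixed before s and e.\<close>

lemma disc_contraction_right_ifs:
  assumes g: "\<And>n. disc_contraction q \<mu> r (g n)" and q: "0 \<le> q" "q < 1" and \<mu>: "0 \<le> \<mu>" "\<mu> < 1"
    and r: "0 \<le> r" "r < 1"
  obtains c where "cmod c < 1"
    "\<And>s e. s < 1 \<Longrightarrow> 0 < e \<Longrightarrow> \<forall>\<^sub>F n in sequentially. right_ifs g n ` cball 0 s \<subseteq> ball c e"
proof -
  define R where "R = right_ifs g"
  define C where "C = cball (0::complex) r"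
  have inv: "g n z \<in> C" if "z \<in> C" for n z
    using g[of n] that by (simp add: disc_contraction_def C_def image_subset_iff)
  have R_lip: "dist (R n z) (R n w) \<le> \<mu> ^ Suc n * dist z w" if "z \<in> C" "w \<in> C" for n z w
    using that
  proof (induction n arbitrary: z w)
    case 0
    then show ?case using g[of 0] by (simp add: R_def C_def disc_contraction_def)
  next
    case (Suc n)
    have "dist (R (Suc n) z) (R (Suc n) w) \<le> \<mu> ^ Suc n * dist (g (Suc n) z) (g (Suc n) w)"
      using Suc.IH[OF inv inv] Suc.prems by (simp add: R_def)
    also have "\<dots> \<le> \<mu> ^ Suc n * (\<mu> * dist z w)"
      using g[of "Suc n"] Suc.prems \<mu> by (intro mult_left_mono) (auto simp: disc_contraction_def C_def)
    finally show ?case by (simp add: mult_ac)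
  qed
  have R_diam: "dist x y \<le> \<mu> ^ n * 2" if xy: "x \<in> R n ` C" "y \<in> R n ` C" for n x y
  proof -
    obtain z w where zw: "z \<in> C" "w \<in> C" "x = R n z" "y = R n w"
      using xy by blast
    have "dist z w \<le> 2"
      using dist_triangle2[of z w 0] zw r by (simp add: C_def)
    then have "\<mu> ^ Suc n * dist z w \<le> (1 * \<mu> ^ n) * 2"
      unfolding power_Suc using \<mu> by (intro mult_mono) auto
    then show ?thesis
      using R_lip[OF zw(1,2), of n] zw by simp
  qed
  have "R (Suc n) ` C \<subseteq> R n ` C" for n
    using inv by (auto simp: R_def)
  then have R_nested: "R m ` C \<subseteq> R n ` C" if "n \<le> m" for m n
    using that by (rule lift_Suc_antimono_le)
  have "0 \<in> C"
    using r by (simp add: C_def)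
  then have R0: "R m 0 \<in> R n ` C" if "n \<le> m" for m n
    using R_nested[OF that] by blast
  have lim2: "(\<lambda>n. \<mu> ^ n * 2) \<longlonglongrightarrow> 0" and limq: "(\<lambda>n. q ^ n * b) \<longlonglongrightarrow> 0" for b
    using tendsto_mult_right[OF LIMSEQ_power_zero[of \<mu>], of 2] tendsto_mult_right[OF LIMSEQ_power_zero[of q], of b]
      q \<mu> by (auto simp: mult.commute)
  have "Cauchy (\<lambda>n. R n 0)"
  proof (rule metric_CauchyI)
    fix e :: real assume "0 < e"
    then obtain N where "\<mu> ^ N * 2 < e"
      using eventually_happens[OF order_tendstoD(2)[OF lim2]] by auto
    then show "\<exists>M. \<forall>m\<ge>M. \<forall>n\<ge>M. dist (R m 0) (R n 0) < e"
      using R_diam[OF R0 R0] by (meson order_le_less_trans)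
  qed
  then obtain c where c: "(\<lambda>n. R n 0) \<longlonglongrightarrow> c"
    using Cauchy_convergent convergent_def by blast
  have R_c: "dist x c \<le> \<mu> ^ n * 2" if "x \<in> R n ` C" for x n
  proof (rule Lim_bounded)
    show "(\<lambda>m. dist x (R m 0)) \<longlonglongrightarrow> dist x c"
      by (intro tendsto_intros c)
    show "\<forall>m\<ge>n. dist x (R m 0) \<le> \<mu> ^ n * 2"
      using R_diam[OF that R0] by blast
  qed
  show thesis
  proof
    have "R n 0 \<in> C" for n
    proof -
      have "R 0 ` C \<subseteq> C" using inv by (auto simp: R_def)
      then show ?thesis using R0[of 0 n] by auto
    qed
    then have "c \<in> C"
      using c by (rule_tac closed_sequentially[of C "\<lambda>n. R n 0"]) (auto simp: C_def)
    then show "cmod c < 1" using r by (simp add: C_def)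
  next
    fix s e :: real assume s: "s < 1" and e: "0 < e"
    obtain M where M: "q ^ M * poinc s < 1"
      using eventually_happens[OF order_tendstoD(2)[OF limq, of 1 "poinc s"]] by auto
    have "\<forall>\<^sub>F n in sequentially. \<mu> ^ n * 2 < e"
      using lim2 e by (rule order_tendstoD)
    then obtain N where N: "\<And>n. N \<le> n \<Longrightarrow> \<mu> ^ n * 2 < e"
      unfolding eventually_sequentially by blast
    have "R n z \<in> ball c e" if n: "N + M \<le> n" and z: "z \<in> cball 0 s" for n z
    proof -
      \<comment> \<open>The M innermost factors bring z into the small disc; the outer composition
        of index n - M then sends it close to c, since n - M \<ge> N.\<close>
      define w where "w = rec_nat z (\<lambda>j. g (n - j))"
      have "cmod (w M) \<le> r"
        by (rule disc_contraction_iterate[where h = "\<lambda>j. g (n - j)" and s = s and n = M])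
          (use g q s z M in \<open>auto simp: w_def\<close>)
      moreover have "R n z = R (n - M) (w M)"
        unfolding R_def w_def using n by (intro right_ifs_split) simp
      ultimately have "dist (R n z) c \<le> \<mu> ^ (n - M) * 2"
        by (intro R_c) (auto simp: C_def)
      also have "\<dots> < e"
        using n by (intro N) simp
      finally show ?thesis by (simp add: dist_commute)
    qed
    then show "\<forall>\<^sub>F n in sequentially. right_ifs g n ` cball 0 s \<subseteq> ball c e"
      unfolding eventually_sequentially R_def by blast
  qed
qed

section \<open>Lifting through coverings\<close>

lemma covering_map_continuous: "covering_map X Y p \<Longrightarrow> continuous_map X Y p"
  and covering_map_surj: "covering_map X Y p \<Longrightarrow> p ` topspace X = topspace Y"
  by (simp_all add: covering_map_def)

lemma covering_map_evenly:
  assumes p: "covering_map X Y p" and y: "y \<in> topspace Y"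
  obtains T \<V> where "y \<in> T" "openin Y T" "\<Union>\<V> = topspace X \<inter> p -` T"
    "\<forall>V \<in> \<V>. openin X V" "pairwise disjnt \<V>"
    "\<forall>V \<in> \<V>. homeomorphic_map (subtopology X V) (subtopology Y T) p"
proof -
  have "\<exists>T. y \<in> T \<and> openin Y T \<and> (\<exists>\<V>. \<Union>\<V> = topspace X \<inter> p -` T \<and>
      (\<forall>V \<in> \<V>. openin X V) \<and> pairwise disjnt \<V> \<and>
      (\<forall>V \<in> \<V>. homeomorphic_map (subtopology X V) (subtopology Y T) p))"
    using p y by (simp add: covering_map_def)
  then show thesis
    by (elim exE conjE) (rule that)
qed

text \<open>The sheets are pulled back along m. Applied to disc automorphisms, this moves the base
  point of the universal covering.\<close>

lemma covering_map_compose_homeomorphic_map: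
  assumes p: "covering_map X Y p" and m: "homeomorphic_map Z X m"
  shows "covering_map Z Y (p \<circ> m)"
  unfolding covering_map_def
proof (intro conjI ballI)
  have cm: "continuous_map Z X m" and im: "m ` topspace Z = topspace X"
    using homeomorphic_imp_continuous_map[OF m] homeomorphic_imp_surjective_map[OF m] by auto
  show "continuous_map Z Y (p \<circ> m)"
    by (rule continuous_map_compose[OF cm covering_map_continuous[OF p]])
  show "(p \<circ> m) ` topspace Z = topspace Y"
    using covering_map_surj[OF p] by (simp add: image_comp[symmetric] im del: o_apply)
  fix y assume y: "y \<in> topspace Y"
  obtain T \<V> where T: "y \<in> T" "openin Y T" and V: "\<Union>\<V> = topspace X \<inter> p -` T"
    "\<forall>V \<in> \<V>. openin X V" "pairwise disjnt \<V>"
    "\<forall>V \<in> \<V>. homeomorphic_map (subtopology X V) (subtopology Y T) p"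
    by (rule covering_map_evenly[OF p y])
  define \<W> where "\<W> = (\<lambda>V. {z \<in> topspace Z. m z \<in> V}) ` \<V>"
  have "\<Union>\<W> = topspace Z \<inter> (p \<circ> m) -` T"
  proof -
    have "\<Union>\<W> = {z \<in> topspace Z. m z \<in> \<Union>\<V>}"
      by (auto simp: \<W>_def)
    also have "\<dots> = topspace Z \<inter> (p \<circ> m) -` T"
      unfolding V(1) using im by auto
    finally show ?thesis .
  qed
  moreover have "openin Z W" if "W \<in> \<W>" for W
    using that openin_continuous_map_preimage[OF cm V(2)[rule_format]] by (auto simp: \<W>_def)
  moreover have "pairwise disjnt \<W>"
    unfolding \<W>_def
  proof (rule pairwise_imageI)
    fix V V' assume "V \<in> \<V>" "V' \<in> \<V>" "V \<noteq> V'"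
    then have "disjnt V V'" using V(3) by (simp add: pairwiseD)
    then show "disjnt {z \<in> topspace Z. m z \<in> V} {z \<in> topspace Z. m z \<in> V'}"
      by (auto simp: disjnt_iff)
  qed
  moreover have "homeomorphic_map (subtopology Z W) (subtopology Y T) (p \<circ> m)" if W: "W \<in> \<W>" for W
  proof -
    obtain V' where V': "V' \<in> \<V>" "W = {z \<in> topspace Z. m z \<in> V'}"
      using W by (auto simp: \<W>_def)
    have "homeomorphic_map (subtopology Z W) (subtopology X V') m"
      using V' im by (intro homeomorphic_map_subtopologies[OF m]) auto
    then show ?thesis
      using V(4)[rule_format, OF V'(1)] by (rule homeomorphic_map_compose)
  qed
  ultimately show "\<exists>T. y \<in> T \<and> openin Y T \<and> (\<exists>\<V>. \<Union>\<V> = topspace Z \<inter> (p \<circ> m) -` T \<and>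
      (\<forall>V\<in>\<V>. openin Z V) \<and> pairwise disjnt \<V> \<and>
      (\<forall>V\<in>\<V>. homeomorphic_map (subtopology Z V) (subtopology Y T) (p \<circ> m)))"
    by (intro exI[of _ T] exI[of _ \<W>] conjI ballI T)
qed

text \<open>In the last clause, the union of the other sheets over T is open and disjoint from V, so
  it cannot meet a connected set over T that meets V. This will locate the image of a lift from a
  single value.\<close>

lemma covering_map_sheet:
  assumes p: "covering_map X Y p" and x: "x \<in> topspace X"
  obtains T V where "openin Y T" "openin X V" "x \<in> V" "p ` V = T"
    "homeomorphic_map (subtopology X V) (subtopology Y T) p"
    "\<And>S. connectedin X S \<Longrightarrow> p ` S \<subseteq> T \<Longrightarrow> S \<inter> V \<noteq> {} \<Longrightarrow> S \<subseteq> V"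
proof -
  have px: "p x \<in> topspace Y"
    using covering_map_surj[OF p] x by blast
  obtain T \<V> where T: "p x \<in> T" "openin Y T" and \<V>: "\<Union>\<V> = topspace X \<inter> p -` T"
    "\<forall>V \<in> \<V>. openin X V" "pairwise disjnt \<V>"
    "\<forall>V \<in> \<V>. homeomorphic_map (subtopology X V) (subtopology Y T) p"
    by (rule covering_map_evenly[OF p px])
  have "x \<in> \<Union>\<V>"
    unfolding \<V>(1) using x T(1) by simp
  then obtain V where V: "V \<in> \<V>" "x \<in> V" ..
  show thesis
  proof
    show "openin Y T" "openin X V" "x \<in> V" "homeomorphic_map (subtopology X V) (subtopology Y T) p"
      by (rule T V \<V>(2)[rule_format, OF V(1)] \<V>(4)[rule_format, OF V(1)])+
    then show "p ` V = T"
      using homeomorphic_imp_surjective_map[of "subtopology X V" "subtopology Y T" p]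
      by (simp add: Int_absorb1 openin_subset)
  next
    fix S assume S: "connectedin X S" "p ` S \<subseteq> T" "S \<inter> V \<noteq> {}"
    have "S \<subseteq> \<Union>\<V>"
      using S(2) \<V>(1) connectedin_subset_topspace[OF S(1)] by auto
    moreover have "V \<inter> \<Union>(\<V> - {V}) = {}"
      using pairwiseD[OF \<V>(3) V(1)] by (fastforce simp: disjnt_iff)
    moreover have "openin X (\<Union>(\<V> - {V}))"
      using \<V>(2) by (intro openin_Union) auto
    moreover have "S \<subseteq> V \<union> \<Union>(\<V> - {V})"
      using \<open>S \<subseteq> \<Union>\<V>\<close> by blast
    ultimately have "S \<inter> \<Union>(\<V> - {V}) = {}"
      using connectedinD[OF S(1) \<V>(2)[rule_format, OF V(1)], of "\<Union>(\<V> - {V})"] S(3) by auto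
    with \<open>S \<subseteq> \<Union>\<V>\<close> show "S \<subseteq> V"
      by blast
  qed
qed

text \<open>On each sheet the covering is a homeomorphism onto an open set. Openness lets images of
  discs serve as target sets in the compact-open topology.\<close>

lemma covering_imp_open_map:
  assumes p: "covering_map X Y p"
  shows "open_map X Y p"
  unfolding open_map_def
proof (intro allI impI)
  fix U assume U: "openin X U"
  have *: "\<exists>W. openin Y W \<and> p x \<in> W \<and> W \<subseteq> p ` U" if x: "x \<in> U" for x
  proof -
    obtain T V where TV: "openin Y T" "openin X V" "x \<in> V"
      "homeomorphic_map (subtopology X V) (subtopology Y T) p"
      by (rule covering_map_sheet[OF p subsetD[OF openin_subset[OF U] x]]) (rule that)
    have "openin (subtopology X V) (U \<inter> V)"
      using U by (simp add: openin_subtopology_Int)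
    then have "openin (subtopology Y T) (p ` (U \<inter> V))"
      using homeomorphic_imp_open_map[OF TV(4)] by (simp add: open_map_def)
    then have "openin Y (p ` (U \<inter> V))"
      using TV(1) by (rule openin_trans_full)
    then show ?thesis using x TV(3) by blast
  qed
  then show "openin Y (p ` U)"
    by (subst openin_subopen) (auto dest: *)
qed

text \<open>
  The library lifts maps only through covering spaces whose base carries a type class topology. Passing
  to the pullback covering of the simply connected set \<open>S\<close> along \<open>h\<close> puts us in that situation: a
  section of the pullback is a lift of \<open>h\<close>.
\<close>

lemma covering_map_lift:
  fixes C :: "'b::real_normed_vector set" and S :: "'c::real_normed_vector set"
  assumes p: "covering_map (top_of_set C) Y p" and h: "continuous_map (top_of_set S) Y h"
    and S: "simply_connected S" "locally path_connected S" and ab: "a \<in> S" "b \<in> C" "p b = h a"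
  obtains g where "continuous_on S g" "g ` S \<subseteq> C" "g a = b" "\<And>x. x \<in> S \<Longrightarrow> p (g x) = h x"
proof -
  define E where "E = {(x, w). x \<in> S \<and> w \<in> C \<and> h x = p w}"
  have pC: "p ` C = topspace Y" and pcont: "continuous_map (top_of_set C) Y p"
    using covering_map_surj[OF p] covering_map_continuous[OF p] by auto
  have hS: "h x \<in> topspace Y" if "x \<in> S" for x
    using h that by (auto simp: continuous_map_def)
  have "covering_space E fst S"
  proof
    show "continuous_on E fst"
      by (intro continuous_intros)
    show "fst ` E = S"
    proof
      show "S \<subseteq> fst ` E"
      proof
        fix x assume "x \<in> S"
        moreover from this obtain w where "w \<in> C" "h x = p w"
          using hS pC by blast
        ultimately have "(x, w) \<in> E" by (simp add: E_def)
        then show "x \<in> fst ` E" by (rule image_eqI[rotated]) simp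
      qed
    qed (auto simp: E_def)
    fix x assume x: "x \<in> S"
    obtain T \<V> where T: "h x \<in> T" "openin Y T" and \<V>: "\<Union>\<V> = C \<inter> p -` T"
      "\<forall>V \<in> \<V>. openin (top_of_set C) V" "pairwise disjnt \<V>"
      "\<forall>V \<in> \<V>. homeomorphic_map (subtopology (top_of_set C) V) (subtopology Y T) p"
      by (rule covering_map_evenly[OF p hS[OF x], unfolded topspace_euclidean_subtopology])
    define N where "N = {x \<in> S. h x \<in> T}"
    define sheet where "sheet V = {z \<in> E. snd z \<in> V \<and> fst z \<in> N}" for V
    have N: "openin (top_of_set S) N"
      using openin_continuous_map_preimage[OF h T(2)] by (simp add: N_def)
    have ope: "openin (top_of_set E) (sheet V)" if V: "V \<in> \<V>" for V
    proof -
      have "openin (top_of_set (S \<times> C)) (N \<times> V)"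
        using N \<V>(2)[rule_format, OF V] by (rule openin_Times)
      then obtain W where W: "open W" "N \<times> V = (S \<times> C) \<inter> W"
        by (metis openin_open)
      have "sheet V = E \<inter> (N \<times> V)" "E \<subseteq> S \<times> C"
        by (auto simp: sheet_def E_def)
      then have "sheet V = E \<inter> W"
        unfolding W(2) by blast
      then show ?thesis
        using W(1) openin_open by blast
    qed
    have hom: "\<exists>q. homeomorphism (sheet V) N fst q" if V: "V \<in> \<V>" for V
    proof -
      have VC: "V \<subseteq> C" using \<V>(2)[rule_format, OF V] openin_imp_subset by blast
      then have top: "subtopology (top_of_set C) V = top_of_set V"
        by (simp add: subtopology_subtopology inf.absorb2)
      obtain q where q: "homeomorphic_maps (top_of_set V) (subtopology Y T) p q"
        using \<V>(4)[rule_format, OF V, unfolded top, unfolded homeomorphic_map_maps] by (elim exE)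
      have TY: "T \<subseteq> topspace Y" using T openin_subset by blast
      have "continuous_map (top_of_set N) (subtopology Y T) h"
        using continuous_map_from_subtopology_mono[OF h, of N]
        by (auto simp: continuous_map_in_subtopology N_def)
      then have qh: "continuous_map (top_of_set N) (top_of_set V) (q \<circ> h)"
        using q unfolding homeomorphic_maps_def by (elim conjE) (rule continuous_map_compose)
      have qp: "q (p w) = w" if "w \<in> V" for w
        using q that by (auto simp: homeomorphic_maps_def)
      have pq: "p (q y) = y" if "y \<in> T" for y
        using q that TY by (auto simp: homeomorphic_maps_def)
      \<comment> \<open>Over N the sheet is the graph of \<open>q \<circ> h\<close>, where q inverts
        p on V.\<close>
      have "homeomorphism (sheet V) N fst (\<lambda>x. (x, (q \<circ> h) x))"
      proof
        show "continuous_on (sheet V) fst"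
          by (intro continuous_intros)
        show "continuous_on N (\<lambda>x. (x, (q \<circ> h) x))"
          using qh by (intro continuous_intros) auto
        show "fst ` sheet V \<subseteq> N"
          by (auto simp: sheet_def)
        show "(\<lambda>x. (x, (q \<circ> h) x)) ` N \<subseteq> sheet V"
          using qh VC pq by (auto simp: sheet_def E_def N_def continuous_map_def)
      qed (auto simp: sheet_def E_def qp)
      then show ?thesis by blast
    qed
    have un: "\<Union>(sheet ` \<V>) = E \<inter> fst -` N"
    proof (intro equalityI subsetI)
      fix z assume z: "z \<in> E \<inter> fst -` N"
      then have "snd z \<in> \<Union>\<V>"
        unfolding \<V>(1) by (cases z) (auto simp: E_def N_def)
      then show "z \<in> \<Union>(sheet ` \<V>)"
        using z by (auto simp: sheet_def)
    qed (auto simp: sheet_def)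
    have "pairwise disjnt (sheet ` \<V>)"
    proof (rule pairwise_imageI)
      fix V V' assume "V \<in> \<V>" "V' \<in> \<V>" "V \<noteq> V'"
      then have "disjnt V V'" using \<V>(3) by (simp add: pairwiseD)
      then show "disjnt (sheet V) (sheet V')"
        by (auto simp: disjnt_iff sheet_def)
    qed
    then show "\<exists>T. x \<in> T \<and> openin (top_of_set S) T \<and>
        (\<exists>v. \<Union>v = E \<inter> fst -` T \<and> (\<forall>u\<in>v. openin (top_of_set E) u) \<and>
          pairwise disjnt v \<and> (\<forall>u\<in>v. \<exists>q. homeomorphism u T fst q))"
      using x T(1) N ope hom un by (intro exI[of _ N] exI[of _ "sheet ` \<V>"] conjI) (auto simp: N_def)
  qed
  then obtain g where g: "continuous_on S g" "g \<in> S \<rightarrow> E" "g a = (a, b)" "\<And>x. x \<in> S \<Longrightarrow> fst (g x) = x"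
    using covering_space_lift_strong[of E fst S "(a, b)" a S id] S ab by (auto simp: E_def)
  show thesis
  proof
    show "continuous_on S (snd \<circ> g)"
      using g(1) by (intro continuous_on_compose continuous_intros) auto
    show "(snd \<circ> g) a = b" using g(3) by simp
    have gE: "snd (g x) \<in> C \<and> p (snd (g x)) = h x" if "x \<in> S" for x
    proof -
      have "g x \<in> E" using g(2) that by blast
      then show ?thesis using g(4)[OF that] by (cases "g x") (simp add: E_def)
    qed
    then show "(snd \<circ> g) ` S \<subseteq> C" by auto
    show "p ((snd \<circ> g) x) = h x" if "x \<in> S" for x
      using gE that by simp
  qed
qed

section \<open>Holomorphic maps and their lifts\<close>

lemma holomorphic_on_locally:
  assumes "\<And>x. x \<in> S \<Longrightarrow> \<exists>N. open N \<and> x \<in> N \<and> f holomorphic_on N"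
  shows "f holomorphic_on S"
  unfolding holomorphic_on_def
  using assms holomorphic_on_imp_differentiable_at field_differentiable_at_within by meson

lemma riemann_surface_chart:
  assumes "riemann_surface X A" "z \<in> topspace X"
  obtains U \<phi> where "(U, \<phi>) \<in> A" "z \<in> U"
proof -
  have "z \<in> (\<Union>(U, \<phi>) \<in> A. U)"
    using assms by (simp add: riemann_surface_def)
  then show thesis
    using that by auto
qed

lemma complex_chart_inj: "complex_chart X U \<phi> \<Longrightarrow> inj_on \<phi> U"
  by (metis complex_chart_inverse inj_on_inverseI)

lemma riemann_surface_complex_chart: "riemann_surface X A \<Longrightarrow> (U, \<phi>) \<in> A \<Longrightarrow> complex_chart X U \<phi>"
  by (auto simp: riemann_surface_def)

lemma holomorphic_maps_continuous: "f \<in> holomorphic_maps X A Y B \<Longrightarrow> continuous_map X Y f"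
  by (simp add: holomorphic_maps_def)

lemma holomorphic_mapsD:
  "f \<in> holomorphic_maps X A Y B \<Longrightarrow> (U, \<phi>) \<in> A \<Longrightarrow> (V, \<psi>) \<in> B \<Longrightarrow>
    (\<psi> \<circ> f \<circ> inv_into U \<phi>) holomorphic_on \<phi> ` (U \<inter> f -` V)"
  by (auto simp: holomorphic_maps_def)

text \<open>Holomorphy is local, so around each point a chart of Y at the intermediate point f z can
  be inserted, which splits the chart expression into two holomorphic factors.\<close>

lemma holomorphic_maps_comp:
  assumes f: "f \<in> holomorphic_maps X A Y B" and g: "g \<in> holomorphic_maps Y B Z C"
    and A: "riemann_surface X A" and B: "riemann_surface Y B" and C: "riemann_surface Z C"
  shows "g \<circ> f \<in> holomorphic_maps X A Z C"
proof -
  note fc = holomorphic_maps_continuous[OF f] and gc = holomorphic_maps_continuous[OF g]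
  have "(\<xi> \<circ> (g \<circ> f) \<circ> inv_into U \<phi>) holomorphic_on \<phi> ` (U \<inter> (g \<circ> f) -` W)"
    if U: "(U, \<phi>) \<in> A" and W: "(W, \<xi>) \<in> C" for U \<phi> W \<xi>
  proof (rule holomorphic_on_locally)
    fix x assume "x \<in> \<phi> ` (U \<inter> (g \<circ> f) -` W)"
    then obtain z where z: "z \<in> U" "g (f z) \<in> W" "x = \<phi> z" by auto
    have cU: "complex_chart X U \<phi>" and oU: "openin X U" and oW: "openin Z W"
      using riemann_surface_complex_chart[OF A U] riemann_surface_complex_chart[OF C W]
      by (auto simp: complex_chart_def)
    have zX: "z \<in> topspace X"
      using z(1) openin_subset[OF oU] by blast
    then have "f z \<in> topspace Y"
      using fc by (auto simp: continuous_map_def)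
    then obtain V \<psi> where V: "(V, \<psi>) \<in> B" "f z \<in> V"
      using riemann_surface_chart[OF B] by blast
    have cV: "complex_chart Y V \<psi>" and oV: "openin Y V"
      using riemann_surface_complex_chart[OF B V(1)] by (auto simp: complex_chart_def)
    define N where "N = U \<inter> {y \<in> topspace X. f y \<in> V} \<inter> {y \<in> topspace X. (g \<circ> f) y \<in> W}"
    have oN: "openin X N"
      unfolding N_def using oU openin_continuous_map_preimage[OF fc oV]
        openin_continuous_map_preimage[OF continuous_map_compose[OF fc gc] oW] by (intro openin_Int)
    have inv: "inv_into U \<phi> (\<phi> y) = y" if "y \<in> N" for y
      using complex_chart_inverse[OF cU] that by (simp add: N_def)
    have "(\<psi> \<circ> f \<circ> inv_into U \<phi>) holomorphic_on \<phi> ` N"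
      using holomorphic_mapsD[OF f U V(1)] by (rule holomorphic_on_subset) (auto simp: N_def)
    then have "((\<xi> \<circ> g \<circ> inv_into V \<psi>) \<circ> (\<psi> \<circ> f \<circ> inv_into U \<phi>)) holomorphic_on \<phi> ` N"
      using holomorphic_mapsD[OF g V(1) W]
    proof (rule holomorphic_on_compose_gen)
      show "(\<psi> \<circ> f \<circ> inv_into U \<phi>) ` \<phi> ` N \<subseteq> \<psi> ` (V \<inter> g -` W)"
        using inv by (auto simp: N_def)
    qed
    then have "(\<xi> \<circ> (g \<circ> f) \<circ> inv_into U \<phi>) holomorphic_on \<phi> ` N"
    proof (rule holomorphic_transform)
      show "((\<xi> \<circ> g \<circ> inv_into V \<psi>) \<circ> (\<psi> \<circ> f \<circ> inv_into U \<phi>)) y = (\<xi> \<circ> (g \<circ> f) \<circ> inv_into U \<phi>) y"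
        if "y \<in> \<phi> ` N" for y
        using that inv complex_chart_inverse[OF cV] by (auto simp: N_def)
    qed
    moreover have "open (\<phi> ` N)"
      using complex_chart_image_open[OF cU oN] by (auto simp: N_def)
    moreover have "x \<in> \<phi> ` N"
      using z zX V by (auto simp: N_def)
    ultimately show "\<exists>N. open N \<and> x \<in> N \<and> (\<xi> \<circ> (g \<circ> f) \<circ> inv_into U \<phi>) holomorphic_on N"
      by blast
  qed
  then show ?thesis
    using continuous_map_compose[OF fc gc] by (auto simp: holomorphic_maps_def)
qed

lemma const_holomorphic_maps: "c \<in> topspace Y \<Longrightarrow> (\<lambda>_. c) \<in> holomorphic_maps X A Y B"
  by (auto simp: holomorphic_maps_def o_def)

lemma Hol_comp: "riemann_surface X A \<Longrightarrow> f \<in> Hol X A \<Longrightarrow> g \<in> Hol X A \<Longrightarrow> g \<circ> f \<in> Hol X A"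
  unfolding Hol_def by (rule holomorphic_maps_comp)

lemma right_ifs_Hol: "riemann_surface X A \<Longrightarrow> (\<And>n. f n \<in> Hol X A) \<Longrightarrow> right_ifs f n \<in> Hol X A"
  by (induction n) (auto intro: Hol_comp)

lemma left_ifs_Hol: "riemann_surface X A \<Longrightarrow> (\<And>n. f n \<in> Hol X A) \<Longrightarrow> left_ifs f n \<in> Hol X A"
  by (induction n) (auto intro: Hol_comp)

section \<open>Holomorphic maps from the disc into a surface, and their lifts\<close>

lemma riemann_surface_disc: "riemann_surface disc_topology disc_atlas"
proof -
  have "connected_space (top_of_set (ball (0::complex) 1))"
    by (metis connected_ball connected_openin connected_space_def topspace_euclidean_subtopology
        connectedin_topspace connected_space_subtopology connectedin_iff_connected)
  moreover have "Hausdorff_space (top_of_set (ball (0::complex) 1))"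
    by (simp add: Hausdorff_space_subtopology)
  moreover have "(id \<circ> inv_into (ball (0::complex) 1) id) holomorphic_on ball 0 1"
    by (rule holomorphic_transform[OF holomorphic_on_id]) (metis comp_apply id_apply image_id f_inv_into_f)
  ultimately show ?thesis
    by (auto simp: riemann_surface_def disc_topology_def disc_atlas_def complex_chart_def subtopology_subtopology)
qed

lemma inv_into_ball_id: "z \<in> ball 0 1 \<Longrightarrow> inv_into (ball 0 1) id z = z"
  by (metis id_apply image_id f_inv_into_f)

lemma holomorphic_maps_disc_chart:
  assumes "h \<in> holomorphic_maps disc_topology disc_atlas X A" "(U, \<psi>) \<in> A"
  shows "(\<psi> \<circ> h) holomorphic_on (ball 0 1 \<inter> h -` U)"
proof -
  have "(\<psi> \<circ> h \<circ> inv_into (ball 0 1) id) holomorphic_on (id ` (ball 0 1 \<inter> h -` U))"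
    by (rule holomorphic_mapsD[OF assms(1) _ assms(2)]) (simp add: disc_atlas_def)
  then show ?thesis
    unfolding image_id id_apply by (rule holomorphic_transform) (simp add: inv_into_ball_id)
qed

lemma disc_holomorphic_maps:
  assumes g: "g holomorphic_on ball 0 1" "g ` ball 0 1 \<subseteq> ball 0 1"
  shows "g \<in> holomorphic_maps disc_topology disc_atlas disc_topology disc_atlas"
proof -
  have "(id \<circ> g \<circ> inv_into (ball 0 1) id) holomorphic_on (id ` (ball 0 1 \<inter> g -` ball 0 1))"
    unfolding image_id id_apply
    by (rule holomorphic_transform[OF holomorphic_on_subset[OF g(1)]]) (auto simp: inv_into_ball_id)
  moreover have "continuous_map disc_topology disc_topology g"
    using g holomorphic_on_imp_continuous_on by (auto simp: disc_topology_def)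
  ultimately show ?thesis
    by (auto simp: holomorphic_maps_def disc_atlas_def)
qed

text \<open>Read in a chart, the covering is locally biholomorphic: it is injective on a sheet. This
  provides holomorphic local inverses and a nonzero derivative.\<close>

lemma holomorphic_covering_in_chart:
  assumes X: "riemann_surface X A" and p: "p \<in> holomorphic_maps disc_topology disc_atlas X A"
    and cov: "covering_map disc_topology X p" and w: "w \<in> ball 0 1" and U: "(U, \<psi>) \<in> A" "p w \<in> U"
  obtains N where "open N" "w \<in> N" "N \<subseteq> ball 0 1" "p ` N \<subseteq> U" "(\<psi> \<circ> p) holomorphic_on N"
    "inj_on (\<psi> \<circ> p) N"
proof -
  have cU: "complex_chart X U \<psi>" and oU: "openin X U"
    using riemann_surface_complex_chart[OF X U(1)] by (auto simp: complex_chart_def)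
  have wD: "w \<in> topspace disc_topology"
    using w by (simp add: disc_topology_def)
  obtain T V where TV: "openin X T" "openin disc_topology V" "w \<in> V"
      "homeomorphic_map (subtopology disc_topology V) (subtopology X T) p"
    by (rule covering_map_sheet[OF cov wD]) (rule that)
  define N where "N = V \<inter> {x \<in> topspace disc_topology. p x \<in> U}"
  have N: "openin disc_topology N"
    unfolding N_def using TV(2) openin_continuous_map_preimage[OF holomorphic_maps_continuous[OF p] oU]
    by (rule openin_Int)
  have ND: "N \<subseteq> ball 0 1"
    by (auto simp: N_def disc_topology_def)
  show thesis
  proof
    show "open N"
      using N unfolding disc_topology_def by (rule openin_open_trans) simp
    show "w \<in> N" "N \<subseteq> ball 0 1" "p ` N \<subseteq> U"
      using TV(3) wD U ND by (auto simp: N_def)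
    show "(\<psi> \<circ> p) holomorphic_on N"
      using holomorphic_maps_disc_chart[OF p U(1)] by (rule holomorphic_on_subset) (use ND in \<open>auto simp: N_def\<close>)
    have "inj_on p (topspace disc_topology \<inter> V)"
      using TV(4) by (auto simp: homeomorphic_map_def)
    then have "inj_on p N"
      by (rule inj_on_subset) (auto simp: N_def)
    moreover have "inj_on \<psi> (p ` N)"
      using complex_chart_inj[OF cU] \<open>p ` N \<subseteq> U\<close> by (rule inj_on_subset)
    ultimately show "inj_on (\<psi> \<circ> p) N"
      by (rule comp_inj_on)
  qed
qed

text \<open>The lift exists topologically because the disc is simply connected. It is holomorphic
  because locally it equals \<open>k \<circ> (\<psi> \<circ> h)\<close>, with k a holomorphic
  inverse of \<open>\<psi> \<circ> p\<close>.\<close>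

lemma holomorphic_covering_lift:
  assumes X: "riemann_surface X A" and p: "p \<in> holomorphic_maps disc_topology disc_atlas X A"
    and cov: "covering_map disc_topology X p" and h: "h \<in> holomorphic_maps disc_topology disc_atlas X A"
    and b: "b \<in> ball 0 1" "p b = h 0"
  obtains g where "g holomorphic_on ball 0 1" "g ` ball 0 1 \<subseteq> ball 0 1" "g 0 = b"
    "\<And>z. z \<in> ball 0 1 \<Longrightarrow> p (g z) = h z"
proof -
  obtain g where g: "continuous_on (ball 0 1) g" "g ` ball 0 1 \<subseteq> ball 0 1" "g 0 = b"
    "\<And>z. z \<in> ball 0 1 \<Longrightarrow> p (g z) = h z"
  proof (rule covering_map_lift)
    show "covering_map (top_of_set (ball 0 1)) X p" "continuous_map (top_of_set (ball 0 1)) X h"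
      using cov holomorphic_maps_continuous[OF h] by (auto simp: disc_topology_def)
    show "simply_connected (ball (0::complex) 1)" "locally path_connected (ball (0::complex) 1)"
      by (auto intro: convex_imp_simply_connected convex_imp_locally_path_connected)
  qed (use b in auto)
  have "g holomorphic_on ball 0 1"
  proof (rule holomorphic_on_locally)
    fix z :: complex assume z: "z \<in> ball 0 1"
    have gz: "g z \<in> ball 0 1" using g(2) z by blast
    then have "p (g z) \<in> topspace X"
      using covering_map_surj[OF cov] by (auto simp: disc_topology_def)
    then obtain U \<psi> where U: "(U, \<psi>) \<in> A" "p (g z) \<in> U"
      using riemann_surface_chart[OF X] by blast
    obtain N where N: "open N" "g z \<in> N" "N \<subseteq> ball 0 1" "p ` N \<subseteq> U" "(\<psi> \<circ> p) holomorphic_on N"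
      "inj_on (\<psi> \<circ> p) N"
      by (rule holomorphic_covering_in_chart[OF X p cov gz U])
    obtain k where k: "k holomorphic_on (\<psi> \<circ> p) ` N" "\<And>x. x \<in> N \<Longrightarrow> k ((\<psi> \<circ> p) x) = x"
      by (rule holomorphic_has_inverse[OF N(5,1,6)]) (rule that)
    define M where "M = ball 0 1 \<inter> g -` N"
    have M: "open M"
      unfolding M_def using g(1) N(1) by (simp add: continuous_open_preimage)
    have "(\<psi> \<circ> h) holomorphic_on M"
      using holomorphic_maps_disc_chart[OF h U(1)]
      by (rule holomorphic_on_subset) (use N(4) g(4) in \<open>force simp: M_def\<close>)
    then have "(k \<circ> (\<psi> \<circ> h)) holomorphic_on M"
      using k(1) by (rule holomorphic_on_compose_gen) (use g(4) in \<open>force simp: M_def\<close>)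
    then have "g holomorphic_on M"
      by (rule holomorphic_transform) (use k(2) g(4) in \<open>force simp: M_def\<close>)
    then show "\<exists>N. open N \<and> z \<in> N \<and> g holomorphic_on N"
      using M z N(2) by (auto simp: M_def)
  qed
  then show thesis
    using g(2-4) by (rule that)
qed

text \<open>If P is the covering and f the map F, both read in the chart, then
  \<open>P \<circ> G = f \<circ> P\<close> near 0. Differentiate at 0 and cancel the nonzero
  derivative of P.\<close>

lemma deriv_lift_fixed_point:
  assumes X: "riemann_surface X A" and p: "p \<in> holomorphic_maps disc_topology disc_atlas X A"
    and cov: "covering_map disc_topology X p" and F: "F \<in> Hol X A" and fp: "F (p 0) = p 0"
    and U: "(U, \<phi>) \<in> A" "p 0 \<in> U"
    and G: "G holomorphic_on ball 0 1" "G 0 = 0" "\<And>z. z \<in> ball 0 1 \<Longrightarrow> p (G z) = F (p z)"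
  shows "deriv G 0 = deriv_in_chart U \<phi> F (p 0)"
proof -
  have cU: "complex_chart X U \<phi>" and oU: "openin X U"
    using riemann_surface_complex_chart[OF X U(1)] by (auto simp: complex_chart_def)
  note inv = complex_chart_inverse[OF cU]
  have z0: "(0::complex) \<in> ball 0 1" by simp
  obtain N where N: "open N" "0 \<in> N" "N \<subseteq> ball 0 1" "p ` N \<subseteq> U" "(\<phi> \<circ> p) holomorphic_on N"
    "inj_on (\<phi> \<circ> p) N"
    by (rule holomorphic_covering_in_chart[OF X p cov z0 U])
  define P where "P = \<phi> \<circ> p"
  define f where "f = \<phi> \<circ> F \<circ> inv_into U \<phi>"
  have P: "P field_differentiable at 0"
    unfolding P_def using N(5,1,2) by (rule holomorphic_on_imp_differentiable_at)
  have P0: "deriv P 0 \<noteq> 0"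
    unfolding P_def using N(5,1,6,2) by (rule holomorphic_injective_imp_regular)
  have Gd: "G field_differentiable at 0"
    using G(1) by (rule holomorphic_on_imp_differentiable_at) auto
  define W where "W = U \<inter> {x \<in> topspace X. F x \<in> U}"
  have Fc: "continuous_map X X F"
    using F holomorphic_maps_continuous unfolding Hol_def by blast
  have W: "openin X W"
    unfolding W_def using oU openin_continuous_map_preimage[OF Fc oU] by (rule openin_Int)
  have "f holomorphic_on \<phi> ` (U \<inter> F -` U)"
    unfolding f_def using F[unfolded Hol_def] U(1) U(1) by (rule holomorphic_mapsD)
  then have "f holomorphic_on \<phi> ` W"
    by (rule holomorphic_on_subset) (auto simp: W_def)
  moreover have "open (\<phi> ` W)"
    using complex_chart_image_open[OF cU W] by (auto simp: W_def)
  moreover have "P 0 \<in> \<phi> ` W"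
    using U fp openin_subset[OF oU] by (auto simp: W_def P_def)
  ultimately have f: "f field_differentiable at (P 0)"
    by (rule holomorphic_on_imp_differentiable_at)
  have "\<forall>\<^sub>F z in nhds 0. (P \<circ> G) z = (f \<circ> P) z"
  proof (rule eventually_mono)
    show "\<forall>\<^sub>F z in nhds 0. z \<in> N"
      using N by (intro eventually_nhds_in_open)
    show "(P \<circ> G) z = (f \<circ> P) z" if z: "z \<in> N" for z
    proof -
      have "z \<in> ball 0 1" "p z \<in> U" using z N(3,4) by auto
      then show ?thesis using G(3)[of z] inv[of "p z"] by (simp add: P_def f_def)
    qed
  qed
  then have "deriv (P \<circ> G) 0 = deriv (f \<circ> P) 0"
    by (rule deriv_cong_ev) simp
  moreover have "deriv (P \<circ> G) 0 = deriv P 0 * deriv G 0"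
    using Gd P G(2) by (subst deriv_chain) auto
  moreover have "deriv (f \<circ> P) 0 = deriv f (P 0) * deriv P 0"
    using P f by (rule deriv_chain)
  ultimately have "deriv G 0 = deriv f (P 0)"
    using P0 by simp
  then show ?thesis
    by (simp add: deriv_in_chart_def f_def P_def)
qed

section \<open>Convergence of iterated function systems\<close>

lemma compact_subset_cball:
  fixes S :: "complex set"
  assumes "compact S" "S \<subseteq> ball 0 1"
  obtains s where "0 \<le> s" "s < 1" "S \<subseteq> cball 0 s"
proof (cases "S = {}")
  case False
  obtain x where x: "x \<in> S" "\<And>y. y \<in> S \<Longrightarrow> cmod y \<le> cmod x"
    using continuous_attains_sup[OF assms(1) False continuous_on_norm_id] by blast
  then have "S \<subseteq> cball 0 (cmod x)" "cmod x < 1"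
    using assms(2) by auto
  then show thesis using that norm_ge_zero by blast
qed (use that[of 0] in auto)

lemma covering_disc_point:
  assumes "covering_map disc_topology X p" "x \<in> topspace X"
  obtains z where "cmod z < 1" "p z = x"
proof -
  have "x \<in> p ` ball 0 1"
    using covering_map_surj[OF assms(1)] assms(2) by (simp add: disc_topology_def)
  then show thesis using that by auto
qed

text \<open>The images of the open discs of radius s < 1 form an increasing open cover of X.\<close>

lemma compactin_subset_covering_image_cball:
  assumes cov: "covering_map disc_topology X p" and K: "compactin X K"
  obtains s where "s < 1" "K \<subseteq> p ` cball 0 s"
proof -
  let ?\<U> = "(\<lambda>s. p ` ball 0 s) ` {0..<1}"
  have "openin disc_topology (ball 0 s)" if "s < 1" for s
    unfolding disc_topology_def using that by (intro open_subset) auto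
  then have "openin X U" if "U \<in> ?\<U>" for U
    using covering_imp_open_map[OF cov] that by (auto simp: open_map_def)
  moreover have "K \<subseteq> \<Union>?\<U>"
  proof
    fix x assume "x \<in> K"
    then have "x \<in> topspace X"
      using compactin_subset_topspace[OF K] by blast
    then obtain z where z: "cmod z < 1" "p z = x"
      by (rule covering_disc_point[OF cov])
    obtain s where "cmod z < s" "s < 1"
      using dense[OF z(1)] by blast
    then have "s \<in> {0..<1}" "x \<in> p ` ball 0 s"
      using z(2) le_less_trans[OF norm_ge_zero, of z s] by auto
    then show "x \<in> \<Union>?\<U>" by blast
  qed
  ultimately obtain \<F> where \<F>: "finite \<F>" "\<F> \<subseteq> ?\<U>" "K \<subseteq> \<Union>\<F>"
    using K unfolding compactin_def by metis
  then obtain I where I: "finite I" "I \<subseteq> {0..<1}" "\<F> = (\<lambda>s. p ` ball 0 s) ` I"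
    by (meson finite_subset_image)
  \<comment> \<open>Inserting 0 keeps the maximum meaningful when I is empty.\<close>
  define s where "s = Max (insert 0 I)"
  have s: "s < 1" "\<And>t. t \<in> I \<Longrightarrow> t \<le> s"
    using I by (auto simp: s_def)
  have "K \<subseteq> p ` cball 0 s"
  proof
    fix x assume "x \<in> K"
    then obtain t z where "t \<in> I" "cmod z < t" "x = p z"
      using \<F>(3) I(3) by auto
    then show "x \<in> p ` cball 0 s"
      using s(2)[of t] by auto
  qed
  then show thesis using s(1) that by blast
qed

text \<open>Being eventually in a set passes to finite intersections and to unions, so it need only
  be checked on the generating sets.\<close>

lemma limitin_topology_generated_by:
  assumes "l \<in> topspace (topology_generated_by \<S>)"
    and S: "\<And>U. U \<in> \<S> \<Longrightarrow> l \<in> U \<Longrightarrow> eventually (\<lambda>n. f n \<in> U) net"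
  shows "limitin (topology_generated_by \<S>) f l net"
  unfolding limitin_def
proof (intro conjI allI impI)
  fix U assume "openin (topology_generated_by \<S>) U \<and> l \<in> U"
  then have "generate_topology_on \<S> U" "l \<in> U"
    by (auto simp: openin_topology_generated_by_iff)
  then show "eventually (\<lambda>n. f n \<in> U) net"
  proof induction
    case (Int a b)
    then show ?case by (auto intro: eventually_conj)
  next
    case (UN K)
    then obtain k where "k \<in> K" "eventually (\<lambda>n. f n \<in> k) net" by blast
    then show ?case by (auto elim!: eventually_mono)
  qed (use S in auto)
qed (use assms in auto)

text \<open>Convergence to a constant can be tested on lifts. The lifts may depend on s and e, as
  they do for left systems; only c is common to all.\<close>

lemma limitin_hol_topology_const:
  assumes cov: "covering_map disc_topology X p" and L: "\<And>n. L n \<in> Hol X A" and c: "c \<in> ball 0 1"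
    and lift: "\<And>s e. s < 1 \<Longrightarrow> 0 < e \<Longrightarrow>
      \<exists>G. (\<forall>n. \<forall>z \<in> ball 0 1. p (G n z) = L n (p z)) \<and>
        (\<forall>\<^sub>F n in sequentially. G n ` cball 0 s \<subseteq> ball c e)"
  shows "limitin (hol_topology X A) L (\<lambda>_. p c) sequentially"
  unfolding hol_topology_def
proof (rule limitin_topology_generated_by)
  have "p c \<in> topspace X"
    using covering_map_surj[OF cov] c by (auto simp: disc_topology_def)
  then show "(\<lambda>_. p c) \<in> topspace (topology_generated_by
      {{f \<in> Hol X A. f ` K \<subseteq> U} | K U. compactin X K \<and> openin X U})"
    using topspace_hol_topology[of X A] const_holomorphic_maps[of "p c" X X A A]
    by (simp add: hol_topology_def Hol_def)
next
  fix S assume "S \<in> {{f \<in> Hol X A. f ` K \<subseteq> U} | K U. compactin X K \<and> openin X U}" "(\<lambda>_. p c) \<in> S"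
  then obtain K U where KU: "compactin X K" "openin X U" "S = {f \<in> Hol X A. f ` K \<subseteq> U}"
    "K = {} \<or> p c \<in> U"
    by auto
  show "\<forall>\<^sub>F n in sequentially. L n \<in> S"
  \<comment> \<open>For empty K the constant map satisfies the condition whatever U is, so
    \<open>p c\<close> need not lie in U.\<close>
  proof (cases "K = {}")
    case True
    then show ?thesis using KU(3) L by simp
  next
    case False
    define W where "W = {z \<in> topspace disc_topology. p z \<in> U}"
    have "openin disc_topology W"
      unfolding W_def using covering_map_continuous[OF cov] KU(2) by (rule openin_continuous_map_preimage)
    then have "open W"
      unfolding disc_topology_def by (rule openin_open_trans) simp
    moreover have "c \<in> W"
      using False KU(4) c by (simp add: W_def disc_topology_def)
    ultimately obtain e where e: "0 < e" "ball c e \<subseteq> W"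
      using open_contains_ball by blast
    obtain s where s: "s < 1" "K \<subseteq> p ` cball 0 s"
      by (rule compactin_subset_covering_image_cball[OF cov KU(1)])
    obtain G where G: "\<And>n z. z \<in> ball 0 1 \<Longrightarrow> p (G n z) = L n (p z)"
      "\<forall>\<^sub>F n in sequentially. G n ` cball 0 s \<subseteq> ball c e"
      using lift[OF s(1) e(1)] by blast
    from G(2) show ?thesis
    proof (rule eventually_mono)
      fix n assume n: "G n ` cball 0 s \<subseteq> ball c e"
      have "L n x \<in> U" if "x \<in> K" for x
      proof -
        from that s(2) obtain z where z: "z \<in> cball 0 s" "x = p z" by blast
        then have "G n z \<in> W" using n e(2) by blast
        moreover have "p (G n z) = L n x"
          using G(1)[of z n] z s(1) by simp
        ultimately show ?thesis by (simp add: W_def)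
      qed
      then show "L n \<in> S" using KU(3) L by auto
    qed
  qed
qed

lemma openin_hol_topology_subbasis:
  "compactin X K \<Longrightarrow> openin X U \<Longrightarrow> openin (hol_topology X A) {f \<in> Hol X A. f ` K \<subseteq> U}"
  unfolding hol_topology_def by (rule topology_generated_by_Basis) blast

section \<open>Lifted iterated systems, choice of base point, and contraction near the fixed
  point\<close>

lemma right_ifs_lift:
  assumes "\<And>n z. z \<in> D \<Longrightarrow> g n z \<in> D \<and> p (g n z) = f n (p z)" "z \<in> D"
  shows "p (right_ifs g n z) = right_ifs f n (p z)"
  using assms(2) by (induction n arbitrary: z) (simp_all add: assms(1))

lemma left_ifs_lift:
  assumes "\<And>n z. z \<in> D \<Longrightarrow> g n z \<in> D \<and> p (g n z) = f n (p z)" "z \<in> D"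
  shows "left_ifs g n z \<in> D \<and> p (left_ifs g n z) = left_ifs f n (p z)"
  by (induction n) (simp_all add: assms)

lemma left_ifs_continuous:
  assumes "\<And>n. continuous_on D (g n)" "\<And>n. g n ` D \<subseteq> D"
  shows "continuous_on D (left_ifs g n) \<and> left_ifs g n ` D \<subseteq> D"
proof (induction n)
  case (Suc n)
  then show ?case
    using assms continuous_on_compose2[of D "g (Suc n)" D "left_ifs g n"]
    by (auto simp: o_def image_subset_iff)
qed (use assms in simp)

text \<open>Precompose the covering with a disc automorphism that takes 0 to a preimage of
  z.\<close>

lemma covering_base_point:
  assumes X: "riemann_surface X A" and p: "p \<in> holomorphic_maps disc_topology disc_atlas X A"
    and cov: "covering_map disc_topology X p" and z: "z \<in> topspace X"
  obtains p' where "p' \<in> holomorphic_maps disc_topology disc_atlas X A" "covering_map disc_topology X p'"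
    "p' 0 = z"
proof -
  obtain a where a: "cmod a < 1" "p a = z"
    by (rule covering_disc_point[OF cov z])
  define m where "m = Moebius_function 0 (- a)"
  have m: "m holomorphic_on ball 0 1" "m ` ball 0 1 \<subseteq> ball 0 1"
    using a Moebius_function_norm_lt_1[of "- a"] by (auto simp: m_def Moebius_function_holomorphic)
  have m': "Moebius_function 0 a holomorphic_on ball 0 1" "Moebius_function 0 a ` ball 0 1 \<subseteq> ball 0 1"
    using a Moebius_function_norm_lt_1[of a] by (auto simp: Moebius_function_holomorphic)
  note mh = disc_holomorphic_maps[OF m] and mh' = disc_holomorphic_maps[OF m']
  have "homeomorphic_maps disc_topology disc_topology m (Moebius_function 0 a)"
    using holomorphic_maps_continuous[OF mh] holomorphic_maps_continuous[OF mh'] a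
    by (simp add: homeomorphic_maps_def m_def Moebius_function_compose disc_topology_def)
  then have "homeomorphic_map disc_topology disc_topology m"
    by (rule homeomorphic_maps_imp_map)
  then show thesis
    using holomorphic_maps_comp[OF mh p riemann_surface_disc riemann_surface_disc X]
      covering_map_compose_homeomorphic_map[OF cov] a
    by (intro that[of "p \<circ> m"]) (auto simp: m_def Moebius_function_of_zero)
qed

text \<open>Near 0 the quotient |G z| / |z| is close to the modulus of the derivative, hence below
  some k < 1. The bound r < e allows the disc to be placed inside a sheet of the covering.\<close>

lemma deriv_less_1_imp_contracts:
  assumes G: "G holomorphic_on ball 0 1" "G 0 = 0" "cmod (deriv G 0) < 1" and e: "0 < e"
  obtains \<kappa> r where "0 < \<kappa>" "\<kappa> < 1" "0 < r" "r < e" "G ` cball 0 r \<subseteq> ball 0 (\<kappa> * r)"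
proof -
  obtain k where k: "cmod (deriv G 0) < k" "k < 1"
    using dense[OF G(3)] by blast
  obtain \<kappa> where \<kappa>: "k < \<kappa>" "\<kappa> < 1"
    using dense[OF k(2)] by blast
  have k0: "0 < k" using k(1) norm_ge_zero order_le_less_trans by blast
  have "(G has_field_derivative deriv G 0) (at 0)"
    using G(1) by (intro holomorphic_derivI[of _ "ball 0 1"]) auto
  then have "((\<lambda>z. G z / z) \<longlongrightarrow> deriv G 0) (at 0)"
    using G(2) by (simp add: has_field_derivative_iff)
  then have "((\<lambda>z. cmod (G z / z)) \<longlongrightarrow> cmod (deriv G 0)) (at 0)"
    by (rule tendsto_norm)
  then have "\<forall>\<^sub>F z in at 0. cmod (G z / z) < k"
    using k(1) by (rule order_tendstoD)
  then obtain d where d: "0 < d" "\<And>z. z \<noteq> 0 \<Longrightarrow> cmod z < d \<Longrightarrow> cmod (G z / z) < k"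
    unfolding eventually_at by auto
  define r where "r = min d e / 2"
  have r: "0 < r" "r < d" "r < e" using d(1) e by (auto simp: r_def)
  have "cmod (G z) < \<kappa> * r" if z: "cmod z \<le> r" for z
  proof (cases "z = 0")
    case True
    then show ?thesis using G(2) k0 \<kappa> r by simp
  next
    case False
    then have "cmod (G z) < k * cmod z"
      using d(2)[of z] z r by (simp add: norm_divide divide_less_eq)
    also have "\<dots> \<le> \<kappa> * r"
      using z k0 \<kappa> by (intro mult_mono) auto
    finally show ?thesis .
  qed
  then show thesis
    using k0 \<kappa> r by (intro that[of \<kappa> r]) auto
qed

theorem theorem1p6:
  fixes X :: "'a topology" and A :: "'a atlas" and F :: "'a \<Rightarrow> 'a" and z\<^sub>0 :: 'a
  assumes "hyperbolic_riemann_surface X A"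
    and "F \<in> Hol X A"
    and "attracting_fixed_point X A F z\<^sub>0"
  shows
    "(\<exists>\<U>. openin (hol_topology X A) \<U> \<and> F \<in> \<U> \<and>
        (\<forall>f :: nat \<Rightarrow> 'a \<Rightarrow> 'a.
           (\<forall>\<nu>. f \<nu> \<in> \<U> \<and> differs_from_id X (f \<nu>)) \<longrightarrow>
           (\<exists>c \<in> topspace X. limitin (hol_topology X A) (right_ifs f) (\<lambda>_. c) sequentially)))
     \<and>
     (\<forall>f :: nat \<Rightarrow> 'a \<Rightarrow> 'a.
        (\<forall>\<nu>. f \<nu> \<in> Hol X A \<and> differs_from_id X (f \<nu>)) \<and>
        limitin (hol_topology X A) f F sequentially \<longrightarrow>
        limitin (hol_topology X A) (left_ifs f) (\<lambda>_. z\<^sub>0) sequentially)"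
proof -
  let ?D = "ball (0::complex) 1"
  have X: "riemann_surface X A"
    using assms(1) by (simp add: hyperbolic_riemann_surface_def)
  have z0: "z\<^sub>0 \<in> topspace X" "F z\<^sub>0 = z\<^sub>0"
    using assms(3) by (auto simp: attracting_fixed_point_def)
  obtain U \<phi> where U: "(U, \<phi>) \<in> A" "z\<^sub>0 \<in> U" "cmod (deriv_in_chart U \<phi> F z\<^sub>0) < 1"
    using assms(3) by (auto simp: attracting_fixed_point_def)
  obtain p\<^sub>1 where "p\<^sub>1 \<in> holomorphic_maps disc_topology disc_atlas X A" "covering_map disc_topology X p\<^sub>1"
    using assms(1) by (auto simp: hyperbolic_riemann_surface_def)
  then obtain p where p: "p \<in> holomorphic_maps disc_topology disc_atlas X A"
    and cov: "covering_map disc_topology X p" and p0: "p 0 = z\<^sub>0"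
    using covering_base_point[OF X _ _ z0(1)] by blast
  note pc = covering_map_continuous[OF cov]
  have pX: "p z \<in> topspace X" if "z \<in> ?D" for z
    using covering_map_surj[OF cov] that by (auto simp: disc_topology_def)
  have p_open: "openin X (p ` ball 0 s)" if "s \<le> 1" for s
  proof -
    have "openin disc_topology (ball 0 s)"
      unfolding disc_topology_def using that by (intro open_subset) auto
    then show ?thesis
      using covering_imp_open_map[OF cov] by (simp add: open_map_def)
  qed
  have lift: "\<exists>g. g holomorphic_on ?D \<and> g ` ?D \<subseteq> ?D \<and> g 0 = b \<and> (\<forall>z \<in> ?D. p (g z) = f (p z))"
    if f: "f \<in> Hol X A" and b: "b \<in> ?D" "p b = f z\<^sub>0" for f b
  proof -
    have "f \<circ> p \<in> holomorphic_maps disc_topology disc_atlas X A"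
      using p f[unfolded Hol_def] riemann_surface_disc X X by (rule holomorphic_maps_comp)
    then show ?thesis
      by (rule holomorphic_covering_lift[OF X p cov _ b(1)]) (use b p0 in auto)
  qed
  obtain G where G: "G holomorphic_on ?D" "G ` ?D \<subseteq> ?D" "G 0 = 0" "\<And>z. z \<in> ?D \<Longrightarrow> p (G z) = F (p z)"
    using lift[OF assms(2), of 0] p0 z0(2) by auto
  have dG: "cmod (deriv G 0) < 1"
    using deriv_lift_fixed_point[OF X p cov assms(2) _ U(1) _ G(1,3,4)] U p0 z0(2) by simp
  have z0D: "0 \<in> topspace disc_topology"
    by (simp add: disc_topology_def)
  obtain T V where TV: "openin X T" "openin disc_topology V" "0 \<in> V" "p ` V = T"
    "homeomorphic_map (subtopology disc_topology V) (subtopology X T) p"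
    "\<And>S. connectedin disc_topology S \<Longrightarrow> p ` S \<subseteq> T \<Longrightarrow> S \<inter> V \<noteq> {} \<Longrightarrow> S \<subseteq> V"
    by (rule covering_map_sheet[OF cov z0D]) (rule that)
  have VD: "V \<subseteq> ?D"
    using openin_subset[OF TV(2)] by (simp add: disc_topology_def)
  have inj: "inj_on p V"
    using TV(5) VD by (simp add: homeomorphic_map_def disc_topology_def inf.absorb2)
  have "open V"
    using TV(2) unfolding disc_topology_def by (rule openin_open_trans) simp
  then obtain e where e: "0 < e" "ball 0 e \<subseteq> V"
    using TV(3) open_contains_ball by blast
  obtain \<kappa> r where \<kappa>: "0 < \<kappa>" "\<kappa> < 1" and r: "0 < r" "r < e" and Gr: "G ` cball 0 r \<subseteq> ball 0 (\<kappa> * r)"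
    by (rule deriv_less_1_imp_contracts[OF G(1,3) dG e(1)])
  have rV: "cball 0 r \<subseteq> V"
    using r e(2) by (auto simp: subset_iff)
  \<comment> \<open>The number e was not chosen below 1; that r < 1 follows from
    \<open>cball 0 r\<close> lying in V and V in the unit disc.\<close>
  have "of_real r \<in> ?D"
    by (rule subsetD[OF VD], rule subsetD[OF rV]) (use r in simp)
  then have r1: "r < 1" using r by simp
  have \<kappa>r: "0 < \<kappa> * r" "\<kappa> * r < r" using \<kappa> r by auto
  then have \<kappa>V: "ball 0 (\<kappa> * r) \<subseteq> V"
    using rV by (auto simp: subset_iff)
  \<comment> \<open>The first set controls a lift on \<open>cball 0 r\<close>, the second its value
    at 0. The minimum with \<kappa> * r makes the chosen preimage of \<open>f z\<^sub>0\<close> lie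
    in V.\<close>
  define \<U> where "\<U> \<beta> = {f \<in> Hol X A. f ` p ` cball 0 r \<subseteq> p ` ball 0 (\<kappa> * r)} \<inter>
    {f \<in> Hol X A. f ` {z\<^sub>0} \<subseteq> p ` ball 0 (min \<beta> (\<kappa> * r))}" for \<beta>
  have "compactin disc_topology (cball 0 r)"
    unfolding disc_topology_def using rV VD by (simp add: compactin_subtopology)
  then have compr: "compactin X (p ` cball 0 r)"
    using pc by (rule image_compactin)
  have \<U>_open: "openin (hol_topology X A) (\<U> \<beta>)" for \<beta>
    unfolding \<U>_def using compr p_open[of "\<kappa> * r"] p_open[of "min \<beta> (\<kappa> * r)"] \<kappa>r r1 z0(1)
    by (intro openin_Int openin_hol_topology_subbasis) auto
  have F\<U>: "F \<in> \<U> \<beta>" if "0 < \<beta>" for \<beta>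
  proof -
    have "F (p z) \<in> p ` ball 0 (\<kappa> * r)" if z: "z \<in> cball 0 r" for z
    proof -
      have "F (p z) = p (G z)" using G(4) z rV VD by (metis subsetD)
      then show ?thesis using Gr z by blast
    qed
    moreover have "F z\<^sub>0 \<in> p ` ball 0 (min \<beta> (\<kappa> * r))"
      using that \<kappa>r p0 z0(2) by (intro image_eqI[of _ _ 0]) auto
    ultimately show ?thesis
      using assms(2) by (auto simp: \<U>_def)
  qed
  have \<U>_lift: "\<exists>g. g holomorphic_on ?D \<and> g ` ?D \<subseteq> ?D \<and> g ` cball 0 r \<subseteq> ball 0 (\<kappa> * r) \<and>
      cmod (g 0) \<le> \<beta> \<and> (\<forall>z \<in> ?D. p (g z) = f (p z))" if f: "f \<in> \<U> \<beta>" for f \<beta>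
  proof -
    have fH: "f \<in> Hol X A" and fr: "f ` p ` cball 0 r \<subseteq> p ` ball 0 (\<kappa> * r)"
      using f by (auto simp: \<U>_def)
    obtain b where b: "cmod b < min \<beta> (\<kappa> * r)" "p b = f z\<^sub>0"
      using f by (auto simp: \<U>_def)
    have bV: "b \<in> V" using b \<kappa>V by auto
    then obtain g where g: "g holomorphic_on ?D" "g ` ?D \<subseteq> ?D" "g 0 = b" "\<And>z. z \<in> ?D \<Longrightarrow> p (g z) = f (p z)"
      using lift[OF fH, of b] b(2) VD by blast
    have pg: "p (g z) \<in> p ` ball 0 (\<kappa> * r)" if "z \<in> cball 0 r" for z
      using g(4)[of z] fr that rV VD by (metis image_eqI subsetD)
    \<comment> \<open>A priori g z is only known modulo the covering. Its image of
      \<open>cball 0 r\<close> is connected, lies over T and meets V at g 0 = b, so it stays in V;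
      there injectivity of p identifies g z with a point of
      \<open>ball 0 (\<kappa> * r)\<close>.\<close>
    have "g ` cball 0 r \<subseteq> V"
    proof (rule TV(6))
      have "connected (g ` cball 0 r)"
        using g(1) rV VD
        by (intro connected_continuous_image holomorphic_on_imp_continuous_on) (auto intro: holomorphic_on_subset)
      moreover have "g ` cball 0 r \<subseteq> ?D"
        using g(2) rV VD by blast
      ultimately show "connectedin disc_topology (g ` cball 0 r)"
        by (simp add: disc_topology_def connectedin_subtopology)
      show "p ` g ` cball 0 r \<subseteq> T"
        using pg \<kappa>V TV(4) by blast
      have "g 0 \<in> g ` cball 0 r"
        using r by (intro imageI) simp
      then show "g ` cball 0 r \<inter> V \<noteq> {}"
        using bV g(3) by blast
    qed
    moreover have "g z \<in> ball 0 (\<kappa> * r)" if "z \<in> cball 0 r" "g z \<in> V" for z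
      using pg[OF that(1)] that(2) inj \<kappa>V by (auto dest: inj_onD)
    ultimately have "g ` cball 0 r \<subseteq> ball 0 (\<kappa> * r)"
      by blast
    then show ?thesis
      using g b(1) by (intro exI[of _ g]) auto
  qed
  have r2: "0 < (1 - \<kappa>) / 2 * r" "(1 - \<kappa>) / 2 * r < 1"
    using \<kappa> r r1 mult_strict_mono[of "(1 - \<kappa>) / 2" 1 r 1] by auto
  show ?thesis
  proof (intro conjI allI impI)
    \<comment> \<open>For right systems the largest admissible inner radius is enough.\<close>
    obtain \<beta> q \<mu> where \<beta>: "0 < \<beta>" "0 \<le> q" "q < 1" "0 \<le> \<mu>" "\<mu> < 1" and
      contr: "\<And>g. g holomorphic_on ?D \<Longrightarrow> g ` ?D \<subseteq> ?D \<Longrightarrow> g ` cball 0 r \<subseteq> ball 0 (\<kappa> * r) \<Longrightarrow>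
        cmod (g 0) \<le> \<beta> \<Longrightarrow> disc_contraction q \<mu> ((1 - \<kappa>) / 2 * r) g"
      by (rule holomorphic_disc_contraction[OF \<kappa> r(1) r1 r2(1) order_refl]) (rule that)
    have "\<exists>c \<in> topspace X. limitin (hol_topology X A) (right_ifs f) (\<lambda>_. c) sequentially"
      if f: "\<And>\<nu>. f \<nu> \<in> \<U> \<beta>" for f
    proof -
      have "\<exists>g. g ` ?D \<subseteq> ?D \<and> disc_contraction q \<mu> ((1 - \<kappa>) / 2 * r) g \<and> (\<forall>z \<in> ?D. p (g z) = f n (p z))" for n
        using \<U>_lift[OF f[of n]] contr by metis
      then obtain g where g: "\<And>n. g n ` ?D \<subseteq> ?D" "\<And>n. disc_contraction q \<mu> ((1 - \<kappa>) / 2 * r) (g n)"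
        "\<And>n z. z \<in> ?D \<Longrightarrow> p (g n z) = f n (p z)"
        by metis
      obtain c where c: "cmod c < 1"
        "\<And>s e. s < 1 \<Longrightarrow> 0 < e \<Longrightarrow> \<forall>\<^sub>F n in sequentially. right_ifs g n ` cball 0 s \<subseteq> ball c e"
        by (rule disc_contraction_right_ifs[OF g(2) \<beta>(2-5) less_imp_le[OF r2(1)] r2(2)]) (rule that)
      have "limitin (hol_topology X A) (right_ifs f) (\<lambda>_. p c) sequentially"
      proof (rule limitin_hol_topology_const[OF cov])
        show "right_ifs f n \<in> Hol X A" for n
          using f by (intro right_ifs_Hol X) (auto simp: \<U>_def)
        fix s e :: real assume "s < 1" "0 < e"
        have "p (right_ifs g n z) = right_ifs f n (p z)" if z: "z \<in> ?D" for n z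
          using g(1,3) z by (intro right_ifs_lift[of ?D]) blast+
        then show "\<exists>G. (\<forall>n. \<forall>z \<in> ?D. p (G n z) = right_ifs f n (p z)) \<and>
            (\<forall>\<^sub>F n in sequentially. G n ` cball 0 s \<subseteq> ball c e)"
          using c(2)[OF \<open>s < 1\<close> \<open>0 < e\<close>] by blast
      qed (use c in simp)
      then show ?thesis
        using pX c(1) by auto
    qed
    then show "\<exists>\<U>. openin (hol_topology X A) \<U> \<and> F \<in> \<U> \<and>
        (\<forall>f. (\<forall>\<nu>. f \<nu> \<in> \<U> \<and> differs_from_id X (f \<nu>)) \<longrightarrow>
           (\<exists>c \<in> topspace X. limitin (hol_topology X A) (right_ifs f) (\<lambda>_. c) sequentially))"
      using \<U>_open F\<U>[OF \<beta>(1)] by (intro exI[of _ "\<U> \<beta>"]) auto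
  next
    fix f :: "nat \<Rightarrow> 'a \<Rightarrow> 'a"
    assume asm: "(\<forall>\<nu>. f \<nu> \<in> Hol X A \<and> differs_from_id X (f \<nu>)) \<and> limitin (hol_topology X A) f F sequentially"
    then have f: "\<And>\<nu>. f \<nu> \<in> Hol X A" by blast
    have "limitin (hol_topology X A) (left_ifs f) (\<lambda>_. p 0) sequentially"
    proof (rule limitin_hol_topology_const[OF cov left_ifs_Hol[OF X f]])
      fix s e :: real assume s: "s < 1" and e: "0 < e"
      \<comment> \<open>For left systems the inner radius must be below e, since the final bound is
        the inner disc itself. Hence \<beta>, N and the lifts all depend on e.\<close>
      define \<rho> where "\<rho> = min (e / 2) ((1 - \<kappa>) / 2 * r)"
      have \<rho>: "0 < \<rho>" "\<rho> \<le> (1 - \<kappa>) / 2 * r" "\<rho> < e"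
        using e r2 by (auto simp: \<rho>_def)
      obtain \<beta> q \<mu> where \<beta>: "0 < \<beta>" "0 \<le> q" "q < 1" and
        contr: "\<And>g. g holomorphic_on ?D \<Longrightarrow> g ` ?D \<subseteq> ?D \<Longrightarrow> g ` cball 0 r \<subseteq> ball 0 (\<kappa> * r) \<Longrightarrow>
          cmod (g 0) \<le> \<beta> \<Longrightarrow> disc_contraction q \<mu> \<rho> g"
        by (rule holomorphic_disc_contraction[OF \<kappa> r(1) r1 \<rho>(1,2)]) (rule that)
      have "\<forall>\<^sub>F n in sequentially. f n \<in> \<U> \<beta>"
        using asm \<U>_open F\<U>[OF \<beta>(1)] by (auto simp: limitin_def)
      then obtain N where N: "\<And>n. N \<le> n \<Longrightarrow> f n \<in> \<U> \<beta>"
        unfolding eventually_sequentially by blast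
      \<comment> \<open>The maps of index below N may be far from F, so any lifts of them are
        taken.\<close>
      have "\<exists>g. g holomorphic_on ?D \<and> g ` ?D \<subseteq> ?D \<and> (N \<le> n \<longrightarrow> disc_contraction q \<mu> \<rho> g) \<and>
          (\<forall>z \<in> ?D. p (g z) = f n (p z))" for n
      proof (cases "N \<le> n")
        case True
        then show ?thesis
          using \<U>_lift[OF N[OF True]] contr by metis
      next
        case False
        have "f n z\<^sub>0 \<in> p ` ?D"
          using holomorphic_maps_continuous[OF f[unfolded Hol_def]] z0(1) covering_map_surj[OF cov]
          by (auto simp: continuous_map_def disc_topology_def)
        then show ?thesis
          using lift[OF f] False by force
      qed
      then obtain g where g: "\<And>n. g n holomorphic_on ?D" "\<And>n. g n ` ?D \<subseteq> ?D"
        "\<And>n. N \<le> n \<Longrightarrow> disc_contraction q \<mu> \<rho> (g n)" "\<And>n z. z \<in> ?D \<Longrightarrow> p (g n z) = f n (p z)"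
        by metis
      have LN: "continuous_on ?D (left_ifs g N)" "left_ifs g N ` ?D \<subseteq> ?D"
        using left_ifs_continuous[of ?D g N] g(1,2) holomorphic_on_imp_continuous_on by blast+
      have sD: "cball 0 s \<subseteq> ?D" using s by auto
      \<comment> \<open>The initial composition sends \<open>cball 0 s\<close> onto a compact subset
        of the open disc, which provides the radius t < 1 from which the contractions start.\<close>
      have "compact (left_ifs g N ` cball 0 s)"
        using LN(1) sD by (intro compact_continuous_image) (auto intro: continuous_on_subset)
      moreover have "left_ifs g N ` cball 0 s \<subseteq> ?D"
        using LN(2) sD by blast
      ultimately obtain t where t: "0 \<le> t" "t < 1" "left_ifs g N ` cball 0 s \<subseteq> cball 0 t"
        by (rule compact_subset_cball)
      have "\<forall>\<^sub>F n in sequentially. left_ifs g n ` cball 0 s \<subseteq> cball 0 \<rho>"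
        by (rule disc_contraction_left_ifs[OF g(3) \<beta>(2,3) t(3,1,2)]) simp
      then have "\<forall>\<^sub>F n in sequentially. left_ifs g n ` cball 0 s \<subseteq> ball 0 e"
        by (rule eventually_mono) (use \<rho>(3) in fastforce)
      moreover have "p (left_ifs g n z) = left_ifs f n (p z)" if z: "z \<in> ?D" for n z
        using left_ifs_lift[of ?D g p f z n] g(2,4) z by blast
      ultimately show "\<exists>G. (\<forall>n. \<forall>z \<in> ?D. p (G n z) = left_ifs f n (p z)) \<and>
          (\<forall>\<^sub>F n in sequentially. G n ` cball 0 s \<subseteq> ball 0 e)"
        by blast
    qed simp
    then show "limitin (hol_topology X A) (left_ifs f) (\<lambda>_. z\<^sub>0) sequentially"
      by (simp add: p0)
  qed
qed

end
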